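(* Every nondiscrete Lie group in which the identity component has index at most $\mathrm{cof}(\mathcal{N})$ is nice; that is, it can be covered by $\mathrm{cof}(\mathcal{N})$ many left translates of a compact set of Haar measure zero.
   Context: All topological groups are assumed to be Hausdorff. Lie groups are (finite-dimensional, real) Lie groups and are not assumed to be second countable (so they may have arbitrarily many connected components). $\mathcal{N}$ denotes the family of Lebesgue null subsets of the real line $\mathbb{R}$, and $\mathrm{cof}(\mathcal{N})=\min\{|\mathcal{H}| : \mathcal{H}\subset\mathcal{N},\ \forall N\in\mathcal{N}\ \exists H\in\mathcal{H}\ N\subset H\}$. A locally compact group $G$ is called nice if there exists a compact set $C\subset G$ of Haar measure zero such that $G$ can be covered by $\mathrm{cof}(\mathcal{N})$ many left translates of $C$, i.e. $G=\bigcup_{a\in A} aC$ for some $A\subset G$ with $|A|\le\mathrm{cof}(\mathcal{N})$. (A set has left Haar measure zero iff it has right Haar measure zero.) *)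

theory Defs
  imports "HOL-Analysis.Analysis"
begin

unbundle cardinal_syntax

text \<open>
  Groups are written additively because \<^class>\<open>topological_group_add\<close> is the library's class of
  topological groups; it does not assume commutativity. The left translate of \<open>C\<close> by \<open>a\<close> is
  \<open>(+) a ` C\<close>.
\<close>

section \<open>The cofinality of the null ideal\<close>

definition cofinal_null :: "real set set \<Rightarrow> bool" where
  "cofinal_null H \<longleftrightarrow>
     H \<subseteq> null_sets lebesgue \<and> (\<forall>N \<in> null_sets lebesgue. \<exists>M \<in> H. N \<subseteq> M)"

text \<open>
  Cardinals are cardinal orders up to \<open>=o\<close>, so the minimum is represented by \<open>|H|\<close> for a
  cofinal family \<open>H\<close> of least cardinality; see \<open>cof_null_is_min\<close>.
\<close>

definition cof_null :: "real set rel" where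
  "cof_null = |SOME H. cofinal_null H \<and> (\<forall>H'. cofinal_null H' \<longrightarrow> |H| \<le>o |H'| )|"

lemma cof_null_is_min:
  shows "\<exists>H. cofinal_null H \<and> cof_null = |H|"
    and "cofinal_null H' \<Longrightarrow> cof_null \<le>o |H'|"
proof -
  let ?P = "\<lambda>H. cofinal_null H \<and> (\<forall>H'. cofinal_null H' \<longrightarrow> |H| \<le>o |H'| )"
  let ?R = "card_of ` Collect cofinal_null"
  have "cofinal_null (null_sets lebesgue)"
    by (auto simp: cofinal_null_def)
  then have "?R \<noteq> {}" by blast
  moreover have "\<forall>r \<in> ?R. Card_order r" using card_of_Card_order by blast
  ultimately have "\<exists>r \<in> ?R. \<forall>r' \<in> ?R. r \<le>o r'"
    by (rule exists_minim_Card_order)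
  then have "\<exists>H. ?P H" by blast
  then have P: "?P (SOME H. ?P H)" by (rule someI_ex)
  then show "\<exists>H. cofinal_null H \<and> cof_null = |H|"
    unfolding cof_null_def by blast
  show "cofinal_null H' \<Longrightarrow> cof_null \<le>o |H'|"
    using P unfolding cof_null_def by blast
qed

section \<open>Haar measure and nice groups\<close>

text \<open>A left Haar measure is a nonzero left-invariant Radon measure on the Borel sets.\<close>

definition left_haar_measure :: "'a::{topological_group_add,t2_space} measure \<Rightarrow> bool" where
  "left_haar_measure \<mu> \<longleftrightarrow>
     sets \<mu> = sets borel \<and>
     emeasure \<mu> UNIV \<noteq> 0 \<and>
     (\<forall>a. \<forall>B \<in> sets borel. emeasure \<mu> ((+) a ` B) = emeasure \<mu> B) \<and>
     (\<forall>K. compact K \<longrightarrow> emeasure \<mu> K < \<infinity>) \<and>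
     (\<forall>B \<in> sets borel. emeasure \<mu> B = (INF U \<in> {U. open U \<and> B \<subseteq> U}. emeasure \<mu> U)) \<and>
     (\<forall>U. open U \<longrightarrow> emeasure \<mu> U = (SUP K \<in> {K. compact K \<and> K \<subseteq> U}. emeasure \<mu> K))"

text \<open>
  On a locally compact group a left Haar measure exists and is unique up to a positive factor, so
  quantifying over all of them is the same as fixing one.
\<close>

definition haar_null :: "'a::{topological_group_add,t2_space} set \<Rightarrow> bool" where
  "haar_null C \<longleftrightarrow> (\<forall>\<mu>. left_haar_measure \<mu> \<longrightarrow> C \<in> null_sets \<mu>)"

definition nice_group :: "'a::{topological_group_add,t2_space} itself \<Rightarrow> bool" where
  "nice_group _ \<longleftrightarrow>
     locally_compact_space (euclidean :: 'a topology) \<and>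
     (\<exists>C :: 'a set. compact C \<and> haar_null C \<and>
        (\<exists>A. |A| \<le>o cof_null \<and> (\<Union>a\<in>A. (+) a ` C) = UNIV))"

section \<open>Lie groups\<close>

text \<open>
  \<open>Ck_on k f S\<close> and \<open>smooth_on f S\<close> are meant for open \<open>S\<close> in finite-dimensional spaces, where
  continuity of all iterated directional derivatives is the usual notion of being \<open>C\<^sup>k\<close>.
\<close>

primrec Ck_on :: "nat \<Rightarrow> ('e::euclidean_space \<Rightarrow> 'f::euclidean_space) \<Rightarrow> 'e set \<Rightarrow> bool" where
  "Ck_on 0 f S \<longleftrightarrow> continuous_on S f"
| "Ck_on (Suc k) f S \<longleftrightarrow>
     (\<forall>x\<in>S. f differentiable (at x)) \<and> (\<forall>v. Ck_on k (\<lambda>x. frechet_derivative f (at x) v) S)"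

definition smooth_on :: "('e::euclidean_space \<Rightarrow> 'f::euclidean_space) \<Rightarrow> 'e set \<Rightarrow> bool" where
  "smooth_on f S \<longleftrightarrow> (\<forall>k. Ck_on k f S)"

text \<open>A chart is a pair \<open>(U, \<phi>)\<close>; the values of \<open>\<phi>\<close> outside \<open>U\<close> are irrelevant.\<close>

type_synonym ('a, 'e) chart = "'a set \<times> ('a \<Rightarrow> 'e)"

definition is_chart :: "('a::topological_space, 'e::euclidean_space) chart \<Rightarrow> bool" where
  "is_chart = (\<lambda>(U, \<phi>). open U \<and> open (\<phi> ` U) \<and> homeomorphism U (\<phi> ` U) \<phi> (inv_into U \<phi>))"

definition smooth_atlas :: "('a::topological_space, 'e::euclidean_space) chart set \<Rightarrow> bool" where
  "smooth_atlas \<A> \<longleftrightarrow>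
     (\<forall>c\<in>\<A>. is_chart c) \<and> \<Union> (fst ` \<A>) = UNIV \<and>
     (\<forall>(U, \<phi>)\<in>\<A>. \<forall>(V, \<psi>)\<in>\<A>. smooth_on (\<lambda>p. \<psi> (inv_into U \<phi> p)) (\<phi> ` (U \<inter> V)))"

text \<open>
  A Lie group is a Hausdorff topological group with a smooth atlas for its topology for which the
  group operations are smooth. No countability is assumed. The dimension is \<open>DIM('e)\<close>, which is
  at least 1; the Lie groups of dimension 0 are exactly the discrete groups.
\<close>

definition lie_group ::
  "('a::{topological_group_add,t2_space}, 'e::euclidean_space) chart set \<Rightarrow> bool" where
  "lie_group \<A> \<longleftrightarrow>
     smooth_atlas \<A> \<and>
     (\<forall>(U, \<phi>)\<in>\<A>. \<forall>(V, \<psi>)\<in>\<A>. \<forall>(W, \<theta>)\<in>\<A>.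
        smooth_on (\<lambda>(p, q). \<theta> (inv_into U \<phi> p + inv_into V \<psi> q))
          {(p, q). p \<in> \<phi> ` U \<and> q \<in> \<psi> ` V \<and> inv_into U \<phi> p + inv_into V \<psi> q \<in> W}) \<and>
     (\<forall>(U, \<phi>)\<in>\<A>. \<forall>(V, \<psi>)\<in>\<A>.
        smooth_on (\<lambda>p. \<psi> (- inv_into U \<phi> p)) {p \<in> \<phi> ` U. - inv_into U \<phi> p \<in> V})"

definition identity_component :: "'a::topological_group_add set" where
  "identity_component = connected_component_set UNIV 0"

definition left_cosets :: "'a::group_add set \<Rightarrow> 'a set set" where
  "left_cosets H = range (\<lambda>a. (+) a ` H)"

end

theory Submission
  imports Defs
begin

text \<open>
  \<^bold>\<open>Idea of the proof.\<close> Fix a chart \<open>\<phi>\<close> with inverse \<open>\<psi>\<close> around the identity, put \<open>e = \<phi> 0\<close>, let \<open>b\<close> be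
  a basis vector of the model space and let \<open>\<gamma> s = \<psi> (e + s b)\<close>. The \<open>b\<close>-coordinate
  \<open>g s q = \<phi> (\<gamma> s + \<psi> q) \<bullet> b\<close> of the left translate of \<open>\<psi> q\<close> by \<open>\<gamma> s\<close> has \<open>s\<close>-derivative \<open>1\<close> at
  \<open>(0, e)\<close>, hence derivative between \<open>1/2\<close> and \<open>2\<close> nearby. No one-parameter subgroup is needed: that
  the curve moves the points transversally to the hyperplanes orthogonal to \<open>b\<close> is enough.
  Let \<open>C\<close> consist of the points near the identity whose \<open>b\<close>-coordinate lies in a compact null set
  \<open>C\<^sub>1 \<subseteq> \<real>\<close>. Two things have to be shown.

  \<^item> \<open>C\<close> is Haar null (\<open>haar_null_if_null_along_curve\<close>). The translates of \<open>C\<close> by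
    \<open>- \<gamma> s\<close> all have the measure of \<open>C\<close>, while for a fixed \<open>x\<close> near the identity the parameters \<open>s\<close> with
    \<open>\<gamma> s + x \<in> C\<close> form a null set, because \<open>\<lambda>s. g s q\<close> multiplies distances by at
    least \<open>1/2\<close>. Fubini's theorem gives measure zero.
  \<^item> A neighbourhood of the identity is covered by \<open>cof(\<N>)\<close> many translates of \<open>C\<close>. This asks for a
    compact null set \<open>C\<^sub>1\<close> and a set \<open>A\<close> of \<open>cof(\<N>)\<close> many parameters such that for every \<open>q\<close> some
    \<open>s \<in> A\<close> has \<open>g s q \<in> C\<^sub>1\<close> (\<open>ex_compact_null_hit_by_shifts\<close>).

  The second point rests on the slalom description of \<open>cof(\<N>)\<close> due to Bartoszynski
  (\<open>slaloms_of_cofinality\<close>): for a fixed width function there are \<open>cof(\<N>)\<close> many slaloms, that is,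
  sequences \<open>S\<close> of finite sets of naturals with \<open>card (S n)\<close> bounded by the width at \<open>n\<close>, such that
  each \<open>f :: nat \<Rightarrow> nat\<close> satisfies \<open>f n \<in> S n\<close> for all \<open>n\<close> for one of them. At stage \<open>n\<close> cut the set
  of points into countably many pieces so small that all points of a piece behave alike at this stage.
  A slalom selects finitely many pieces at each stage, boundedly many in advance. So one can remove from an
  interval an open set \<open>V\<^sub>n\<close> of almost full measure and still find, inside every parameter interval of
  the current length, a shorter interval of parameters \<open>s\<close> with \<open>g s q \<notin> V\<^sub>n\<close> for all \<open>q\<close> in the selected pieces
  (\<open>ex_escapable\<close>). What remains after removing all \<open>V\<^sub>n\<close> is \<open>C\<^sub>1\<close>, and the nested parameter
  intervals of a slalom have a common parameter, which works for all points the slalom captures.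

  Finally the identity component is covered by countably many translates of any compact neighbourhood of
  the identity, and by hypothesis the whole group is a union of \<open>cof(\<N>)\<close> many of its cosets
  (\<open>nice_group_if_locally_covered\<close>).
\<close>

section \<open>Reals with prescribed nonzero digits\<close>

text \<open>
  The reals whose digit number \<open>m + 1\<close> after the point in base \<open>B\<close> is zero. The inequalities are
  strict, which drops countably many points and makes the set open.
\<close>

definition zero_digit :: "nat \<Rightarrow> nat \<Rightarrow> real set" where
  "zero_digit B m = {y. \<exists>z::int. of_int z < real B ^ m * y \<and> real B ^ m * y < of_int z + 1 / real B}"

text \<open>The reals that avoid \<open>zero_digit B m\<close> for all \<open>m \<in> S\<close>; a closed set with period \<open>1\<close>.\<close>

definition no_zero_digit :: "nat \<Rightarrow> nat set \<Rightarrow> real set" where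
  "no_zero_digit B S = - (\<Union>m\<in>S. zero_digit B m)"

lemma open_zero_digit: "open (zero_digit B m)"
proof -
  have eq: "zero_digit B m = (\<Union>z::int. {y. of_int z < real B ^ m * y} \<inter> {y. real B ^ m * y < of_int z + 1 / real B})"
    unfolding zero_digit_def by auto
  show ?thesis
    unfolding eq by (intro open_UN ballI open_Int open_Collect_less continuous_intros)
qed

lemma closed_no_zero_digit: "closed (no_zero_digit B S)"
  unfolding no_zero_digit_def by (intro closed_Compl open_UN ballI open_zero_digit)

lemma zero_digit_add_int: "y + of_int j \<in> zero_digit B m \<longleftrightarrow> y \<in> zero_digit B m"
proof -
  have shift: "x + of_int i \<in> zero_digit B m" if "x \<in> zero_digit B m" for x i
  proof -
    from that obtain z :: int where z: "of_int z < real B ^ m * x" "real B ^ m * x < of_int z + 1 / real B"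
      unfolding zero_digit_def by auto
    show ?thesis
      unfolding zero_digit_def
      using z by (intro CollectI exI[of _ "z + int B ^ m * i"]) (simp add: algebra_simps)
  qed
  from shift[of y j] shift[of "y + of_int j" "- j"] show ?thesis by auto
qed

lemma zero_digit_Suc: "y \<in> zero_digit B (Suc m) \<longleftrightarrow> real B * y \<in> zero_digit B m"
  by (simp add: zero_digit_def algebra_simps)

lemma no_zero_digit_add_int: "y + of_int j \<in> no_zero_digit B S \<longleftrightarrow> y \<in> no_zero_digit B S"
  by (simp add: no_zero_digit_def zero_digit_add_int)

lemma lmeasurable_no_zero_digit: "{0..1} \<inter> no_zero_digit B S \<in> lmeasurable"
  by (intro lmeasurable_compact compact_Int_closed closed_no_zero_digit) auto

text \<open>
  Digits are independent. The induction splits \<open>{0..1}\<close> according to the first digit; each of the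
  \<open>B\<close> or \<open>B - 1\<close> admissible parts is a copy, scaled by \<open>1 / B\<close>, of the set for the shifted index set.
\<close>

lemma measure_no_zero_digit_le:
  assumes B: "B \<ge> 1" and "finite S"
  shows "measure lebesgue ({0..1} \<inter> no_zero_digit B S) \<le> (1 - 1 / real B) ^ card S"
proof -
  have "measure lebesgue ({0..1} \<inter> no_zero_digit B S) \<le> (1 - 1 / real B) ^ card S" 
    if "S \<subseteq> {..<k}" for k S
    using that
  proof (induction k arbitrary: S)
    case 0
    have "measure lebesgue ({0..1} \<inter> no_zero_digit B {}) \<le> measure lebesgue {0..1::real}"
      by (intro measure_mono_fmeasurable) (use lmeasurable_no_zero_digit[of B "{}"] in auto)
    with 0 show ?case by simp
  next
    case (Suc k)
    define S' where "S' = {m. Suc m \<in> S}"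
    define T where "T = {0..1} \<inter> no_zero_digit B S'"
    define J where "J = (if 0 \<in> S then {1..<B} else {0..<B})"
    define P where "P j = (\<lambda>x. (1 / real B) *\<^sub>R x + real j / real B) ` T" for j
    have S': "S' \<subseteq> {..<k}" using Suc.prems by (auto simp: S'_def)
    have Tle: "measure lebesgue T \<le> (1 - 1 / real B) ^ card S'"
      unfolding T_def by (rule Suc.IH[OF S'])
    have Tm: "T \<in> lmeasurable" unfolding T_def by (rule lmeasurable_no_zero_digit)
    have cT: "compact T" unfolding T_def by (intro compact_Int_closed closed_no_zero_digit) auto
    have finS: "finite S" using Suc.prems finite_subset by auto
    have finS': "finite S'" using S' finite_subset by auto
    have Seq: "S = Suc ` S' \<union> (S \<inter> {0})"
      by (auto simp: S'_def image_iff) (metis not0_implies_Suc)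
    have card: "card S = card S' + (if 0 \<in> S then 1 else 0)"
    proof -
      have "card S = card (Suc ` S') + card (S \<inter> {0})"
        by (subst Seq, rule card_Un_disjoint) (auto simp: finS')
      then show ?thesis by (auto simp: card_image)
    qed
    \<comment> \<open>The endpoints are separate cases: \<open>0\<close> lies in none of the sets \<open>zero_digit B m\<close> although all its
      digits are zero, and the first digit of \<open>1\<close> would come out as \<open>B\<close>.\<close>
    have sub: "{0..1} \<inter> no_zero_digit B S \<subseteq> (\<Union>j\<in>J. P j) \<union> {0, 1}"
    proof
      fix y assume y: "y \<in> {0..1} \<inter> no_zero_digit B S"
      show "y \<in> (\<Union>j\<in>J. P j) \<union> {0, 1}"
      proof (cases "y = 0 \<or> y = 1")
        case False
        with y have y01: "0 < y" "y < 1" by auto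
        define j where "j = nat \<lfloor>real B * y\<rfloor>"
        have jf: "real j = of_int \<lfloor>real B * y\<rfloor>" unfolding j_def using y01 by simp
        have j1: "real j \<le> real B * y" "real B * y < real j + 1" unfolding jf by linarith+
        have "real B * y < real B" using y01 B by simp
        with j1 have jB: "j < B" by linarith
        define x where "x = real B * y - real j"
        have x01: "x \<in> {0..1}" unfolding x_def using j1 by auto
        have "x + of_int (int j) \<in> no_zero_digit B S'"
          unfolding x_def using y by (auto simp: no_zero_digit_def S'_def zero_digit_Suc)
        then have "x \<in> T" unfolding T_def using x01 no_zero_digit_add_int by blast
        moreover have "y = (1 / real B) *\<^sub>R x + real j / real B"
          unfolding x_def using B by (simp add: field_simps)
        ultimately have "y \<in> P j" unfolding P_def by blast
        moreover have "j \<in> J"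
        proof (cases "0 \<in> S")
          case True
          have "j \<noteq> 0"
          proof
            assume "j = 0"
            then have "of_int 0 < real B ^ 0 * y \<and> real B ^ 0 * y < of_int 0 + 1 / real B"
              using j1 y01 B by (simp add: field_simps)
            then have "y \<in> zero_digit B 0" unfolding zero_digit_def by blast
            with True y show False by (auto simp: no_zero_digit_def)
          qed
          with jB True show ?thesis by (auto simp: J_def)
        qed (use jB in \<open>auto simp: J_def\<close>)
        ultimately show ?thesis by blast
      qed auto
    qed
    have Pm: "P j \<in> lmeasurable" for j
      unfolding P_def by (intro lmeasurable_compact compact_continuous_image[OF _ cT] continuous_intros)
    have lm01: "{0, 1::real} \<in> lmeasurable"
      by (rule lmeasurable_compact[OF finite_imp_compact]) simp
    have m01: "measure lebesgue {0, 1::real} = 0"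
      by (rule negligible_imp_measure0) (simp add: negligible_finite)
    have mP: "measure lebesgue (P j) = measure lebesgue T / real B" for j
      unfolding P_def using Tm B by (subst measure_lebesgue_affine) auto
    have "measure lebesgue ({0..1} \<inter> no_zero_digit B S) \<le> measure lebesgue ((\<Union>j\<in>J. P j) \<union> {0, 1})"
    proof (intro measure_mono_fmeasurable sub)
      show "(\<Union>j\<in>J. P j) \<union> {0, 1} \<in> lmeasurable"
      proof (rule fmeasurable.Un)
        show "(\<Union>j\<in>J. P j) \<in> lmeasurable"
          by (intro fmeasurable.finite_UN Pm) (auto simp: J_def)
      qed (rule lm01)
    qed (simp add: lmeasurable_no_zero_digit fmeasurableD)
    also have "\<dots> \<le> measure lebesgue (\<Union>j\<in>J. P j) + measure lebesgue {0, 1::real}"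
      by (intro measure_Un_le fmeasurableD fmeasurable.finite_UN) (auto simp: Pm J_def lm01)
    also have "\<dots> \<le> (\<Sum>j\<in>J. measure lebesgue (P j))"
      unfolding m01 add_0_right by (intro measure_UNION_le) (auto simp: fmeasurableD[OF Pm] J_def)
    also have "\<dots> = real (card J) / real B * measure lebesgue T" by (simp add: mP)
    also have "real (card J) / real B = (if 0 \<in> S then 1 - 1 / real B else 1)"
      using B by (auto simp: J_def field_simps)
    also have "\<dots> * measure lebesgue T \<le> \<dots> * (1 - 1 / real B) ^ card S'"
      using B by (intro mult_left_mono Tle) auto
    also have "\<dots> = (1 - 1 / real B) ^ card S" by (simp add: card)
    finally show ?case .
  qed
  moreover obtain k where "S \<subseteq> {..<k}" using \<open>finite S\<close> finite_nat_iff_bounded by auto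
  ultimately show ?thesis by blast
qed

lemma measure_zero_digit_le:
  assumes B: "B \<ge> 1"
  shows "measure lebesgue ({0<..<1} \<inter> zero_digit B m) \<le> 1 / real B"
proof -
  define P where "P z = {real z / real B ^ m .. real z / real B ^ m + 1 / real B ^ Suc m}" for z :: nat
  have pos: "real B ^ m > 0" using B by simp
  have sub: "{0<..<1} \<inter> zero_digit B m \<subseteq> (\<Union>z<B ^ m. P z)"
  proof
    fix y assume y: "y \<in> {0<..<1} \<inter> zero_digit B m"
    then obtain z :: int where z: "of_int z < real B ^ m * y" "real B ^ m * y < of_int z + 1 / real B"
      unfolding zero_digit_def by auto
    have "1 / real B \<le> 1" using B by simp
    moreover have "0 < real B ^ m * y" using y pos by simp
    ultimately have "(of_int z::real) > -1" using z by linarith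
    then have z0: "z \<ge> 0" by linarith
    have "real B ^ m * y < real B ^ m * 1" using y pos by (intro mult_strict_left_mono) auto
    with z(1) have "of_int z < real B ^ m * 1" by linarith
    then have "z < int (B ^ m)" by (metis mult.right_neutral of_int_less_iff of_int_of_nat_eq of_nat_power)
    then have "nat z < B ^ m" using z0 by linarith
    moreover have "y \<in> P (nat z)"
    proof -
      have "real (nat z) / real B ^ m \<le> y"
        using z(1) z0 pos by (simp add: divide_le_eq mult.commute)
      moreover have "y \<le> (of_int z + 1 / real B) / real B ^ m"
        using z(2) pos by (simp add: le_divide_eq mult.commute)
      ultimately show ?thesis unfolding P_def using z0 B by (simp add: add_divide_distrib mult.commute)
    qed
    ultimately show "y \<in> (\<Union>z<B ^ m. P z)" by blast
  qed
  have "measure lebesgue ({0<..<1} \<inter> zero_digit B m) \<le> measure lebesgue (\<Union>z<B ^ m. P z)"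
    using sub by (intro measure_mono_fmeasurable fmeasurable.finite_UN)
       (auto simp: P_def intro!: fmeasurableD[OF lmeasurable_open] open_zero_digit)
  also have "\<dots> \<le> (\<Sum>z<B ^ m. measure lebesgue (P z))"
    by (intro measure_UNION_le) (auto simp: P_def)
  also have "\<dots> = 1 / real B" using B by (simp add: P_def)
  finally show ?thesis .
qed

section \<open>Slaloms and the cofinality of the null ideal\<close>

lemma cof_null_infinite: "infinite (Field cof_null)"
proof -
  obtain H where H: "cofinal_null H" "cof_null = |H|" using cof_null_is_min(1) by blast
  have "infinite H"
  proof
    assume fin: "finite H"
    then have "negligible (\<Union>H)"
      using H(1) by (intro negligible_Union) (auto simp: cofinal_null_def negligible_iff_null_sets)
    then have "\<Union>H \<noteq> UNIV"
      using non_negligible_UNIV by metis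
    then obtain x where x: "x \<notin> \<Union>H" by blast
    have "{x} \<in> null_sets lebesgue" by (simp add: negligible_iff_null_sets[symmetric])
    with H(1) obtain M where "M \<in> H" "{x} \<subseteq> M" unfolding cofinal_null_def by blast
    with x show False by blast
  qed
  then show ?thesis unfolding H(2) Field_card_of .
qed

lemma cof_null_Card_order: "Card_order cof_null"
  using cof_null_is_min(1) card_of_Card_order by metis

lemma countable_le_cof_null:
  assumes "countable A" shows "|A| \<le>o cof_null"
proof -
  have "|A| \<le>o |UNIV :: nat set|" using assms card_of_ordLeq unfolding countable_def by blast
  also have "|UNIV :: nat set| \<le>o |Field cof_null|"
    using cof_null_infinite infinite_iff_card_of_nat by blast
  finally show ?thesis
    by (rule ordLeq_ordIso_trans[OF _ card_of_Field_ordIso[OF cof_null_Card_order]])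
qed

lemma Times_le_cof_null:
  "|A| \<le>o cof_null \<Longrightarrow> |B| \<le>o cof_null \<Longrightarrow> |A \<times> B| \<le>o cof_null"
  by (rule card_of_Times_ordLeq_infinite_Field[OF cof_null_infinite _ _ cof_null_Card_order])

lemma image_le_cof_null: "|A| \<le>o cof_null \<Longrightarrow> |f ` A| \<le>o cof_null"
  by (rule ordLeq_transitive[OF card_of_image])

lemma subset_le_cof_null: "|B| \<le>o cof_null \<Longrightarrow> A \<subseteq> B \<Longrightarrow> |A| \<le>o cof_null"
  by (rule ordLeq_transitive[OF card_of_mono1])

text \<open>Local positivity is what lets the Baire category theorem produce sets of positive measure.\<close>

lemma closed_locally_positive_avoiding_null:
  fixes M :: "real set"
  assumes "M \<in> null_sets lebesgue"
  shows "\<exists>K. closed K \<and> K \<noteq> {} \<and> K \<subseteq> {0<..<1} \<and> K \<inter> M = {} \<and>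
     (\<forall>I. open I \<longrightarrow> K \<inter> I \<noteq> {} \<longrightarrow> measure lebesgue (K \<inter> I) > 0)"
proof -
  have Ms: "M \<in> sets lebesgue" using assms by auto
  obtain U where U: "open U" "M \<subseteq> U" "U - M \<in> lmeasurable" "emeasure lebesgue (U - M) < ennreal (1/2)"
    by (rule sets_lebesgue_outer_open[OF Ms, of "1/2"]) auto
  have mU: "emeasure lebesgue U < ennreal (1/2)"
  proof -
    have "emeasure lebesgue U = emeasure lebesgue ((U - M) \<union> M)" using U(2) by (simp add: Un_absorb2)
    also have "\<dots> = emeasure lebesgue (U - M)" by (rule emeasure_Un_null_set[OF _ assms]) (use U in auto)
    finally show ?thesis using U by simp
  qed
  define L where "L = {1/8..7/8} - U"
  have cL: "closed L" unfolding L_def using U(1) by (simp add: closed_Diff)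
  have Lpos: "emeasure lebesgue L > 0"
  proof (rule ccontr)
    assume "\<not> ?thesis"
    then have L0: "emeasure lebesgue L = 0" by simp
    have "ennreal (3/4) = emeasure lebesgue {1/8..7/8::real}" by simp
    also have "\<dots> \<le> emeasure lebesgue (L \<union> U)"
      using cL U(1) by (intro emeasure_mono) (auto simp: L_def)
    also have "\<dots> \<le> emeasure lebesgue L + emeasure lebesgue U"
      using cL U(1) by (intro emeasure_subadditive) auto
    also have "\<dots> \<le> ennreal (1/2)" using L0 mU by simp
    finally have "3/4 \<le> (1/2 :: real)" by (subst (asm) ennreal_le_iff) auto
    then show False by simp
  qed
  obtain \<B> :: "real set set" where \<B>: "countable \<B>" "topological_basis \<B>"
    using ex_countable_basis by blast
  \<comment> \<open>Remove the basic open sets that meet \<open>L\<close> in a null set.\<close>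
  define Z where "Z = \<Union>{I \<in> \<B>. emeasure lebesgue (L \<inter> I) = 0}"
  have oB: "open I" if "I \<in> \<B>" for I using that \<B>(2) topological_basis_open by blast
  define K where "K = L - Z"
  have "closed K" unfolding K_def Z_def using cL oB by auto
  have LZ: "L \<inter> Z \<in> null_sets lebesgue"
  proof -
    have "(\<Union>I\<in>{I \<in> \<B>. emeasure lebesgue (L \<inter> I) = 0}. L \<inter> I) \<in> null_sets lebesgue"
      using \<B>(1) cL oB by (intro null_sets_UN') (auto simp: null_sets_def)
    also have "(\<Union>I\<in>{I \<in> \<B>. emeasure lebesgue (L \<inter> I) = 0}. L \<inter> I) = L \<inter> Z" unfolding Z_def by blast
    finally show ?thesis .
  qed
  have KI: "emeasure lebesgue (K \<inter> I) = emeasure lebesgue (L \<inter> I)" if "open I" for I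
  proof -
    have "K \<inter> I = (L \<inter> I) - (L \<inter> Z)" unfolding K_def by blast
    then show ?thesis using LZ that cL by (simp add: emeasure_Diff_null_set)
  qed
  show ?thesis
  proof (intro exI conjI allI impI)
    show "closed K" by fact
    show "K \<noteq> {}" using KI[of UNIV] Lpos by auto
    show "K \<subseteq> {0<..<1}" "K \<inter> M = {}" unfolding K_def L_def using U(2) by auto
    fix I :: "real set" assume I: "open I" "K \<inter> I \<noteq> {}"
    then obtain x where x: "x \<in> K" "x \<in> I" by blast
    obtain I' where I': "I' \<in> \<B>" "x \<in> I'" "I' \<subseteq> I"
      using topological_basisE[OF \<B>(2) I(1) x(2)] by blast
    have "emeasure lebesgue (L \<inter> I') \<noteq> 0" using x I' unfolding K_def Z_def by blast
    moreover have "emeasure lebesgue (L \<inter> I') \<le> emeasure lebesgue (K \<inter> I)"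
      unfolding KI[OF I(1)] using I'(3) cL I(1) by (intro emeasure_mono) auto
    ultimately have ne: "emeasure lebesgue (K \<inter> I) \<noteq> 0" by auto
    have "K \<inter> I \<in> lmeasurable"
    proof (rule bounded_set_imp_lmeasurable)
      show "bounded (K \<inter> I)" using \<open>K \<subseteq> {0<..<1}\<close>
        by (intro bounded_subset[OF bounded_closed_interval[of 0 1]]) auto
      show "K \<inter> I \<in> sets lebesgue" using \<open>closed K\<close> I(1) by auto
    qed
    then have "emeasure lebesgue (K \<inter> I) = ennreal (measure lebesgue (K \<inter> I))"
      by (rule emeasure_eq_measure2)
    with ne have "measure lebesgue (K \<inter> I) \<noteq> 0" by auto
    then show "measure lebesgue (K \<inter> I) > 0"
      using measure_nonneg[of lebesgue "K \<inter> I"] by linarith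
  qed
qed

lemma null_limsup_zero_digit:
  fixes f :: "nat \<Rightarrow> nat"
  shows "limsup (\<lambda>n. {0<..<1} \<inter> zero_digit (2 ^ Suc n) (f n)) \<in> null_sets lebesgue"
proof (rule borel_cantelli_limsup1)
  have lm: "{0<..<1} \<inter> zero_digit B m \<in> lmeasurable" for B m
    by (intro lmeasurable_open open_Int open_zero_digit open_greaterThanLessThan
        bounded_subset[OF bounded_closed_interval[of 0 1]]) auto
  show "{0<..<1} \<inter> zero_digit (2 ^ Suc n) (f n) \<in> sets lebesgue" for n
    using lm by (rule fmeasurableD)
  show "emeasure lebesgue ({0<..<1} \<inter> zero_digit (2 ^ Suc n) (f n)) < \<infinity>" for n
    using fmeasurableD2[OF lm[of "2 ^ Suc n" "f n"]] by (simp add: less_top)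
  show "summable (\<lambda>n. measure lebesgue ({0<..<1} \<inter> zero_digit (2 ^ Suc n) (f n)))"
  proof (rule summable_comparison_test'[OF summable_geometric, of "1/2" 0])
    fix n
    have "measure lebesgue ({0<..<1} \<inter> zero_digit (2 ^ Suc n) (f n)) \<le> 1 / real (2 ^ Suc n)"
      by (rule measure_zero_digit_le) simp
    also have "\<dots> \<le> (1/2) ^ n" by (simp add: power_divide frac_le)
    finally show "norm (measure lebesgue ({0<..<1} \<inter> zero_digit (2 ^ Suc n) (f n))) \<le> (1/2) ^ n" by simp
  qed simp
qed

text \<open>
  The width is chosen so that \<open>(1 - 1 / 2 ^ Suc n) ^ (n * 2 ^ Suc n)\<close> tends to \<open>0\<close>; the summand \<open>1\<close>
  leaves room for a singleton at \<open>n = 0\<close>.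
\<close>

definition slalom_width :: "nat \<Rightarrow> nat" where
  "slalom_width n = n * 2 ^ Suc n + 1"

text \<open>
  Every \<open>f\<close> is coded by the null set of the reals that lie in infinitely many of the sets
  \<open>zero_digit (2 ^ Suc n) (f n)\<close>. A null set \<open>M\<close> from a cofinal family that contains this code yields,
  through a closed set \<open>K M\<close> disjoint from \<open>M\<close>, countably many slaloms: \<open>n\<close> is sent to the set of
  all \<open>m\<close> for which the open set number \<open>(n, m)\<close> misses a basic open part of \<open>K M\<close>. Since this part
  has positive measure, independence of digits bounds the number of such \<open>m\<close>.
\<close>

lemma slaloms_of_cofinality:
  "\<exists>\<S> :: (nat \<Rightarrow> nat set) set. |\<S>| \<le>o cof_null \<and>
     (\<forall>S\<in>\<S>. \<forall>n. finite (S n) \<and> card (S n) \<le> slalom_width n) \<and>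
     (\<forall>f. \<exists>S\<in>\<S>. \<forall>n. f n \<in> S n)"
proof -
  obtain H where H: "cofinal_null H" "cof_null = |H|" using cof_null_is_min(1) by blast
  define G where "G n m = zero_digit (2 ^ Suc n) m" for n m
  have "\<forall>M\<in>H. \<exists>K. closed K \<and> K \<noteq> {} \<and> K \<subseteq> {0<..<1} \<and> K \<inter> M = {} \<and>
     (\<forall>I. open I \<longrightarrow> K \<inter> I \<noteq> {} \<longrightarrow> measure lebesgue (K \<inter> I) > 0)"
  proof
    fix M assume "M \<in> H"
    then have "M \<in> null_sets lebesgue" using H(1) by (auto simp: cofinal_null_def)
    then show "\<exists>K. closed K \<and> K \<noteq> {} \<and> K \<subseteq> {0<..<1} \<and> K \<inter> M = {} \<and>
       (\<forall>I. open I \<longrightarrow> K \<inter> I \<noteq> {} \<longrightarrow> measure lebesgue (K \<inter> I) > 0)"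
      by (rule closed_locally_positive_avoiding_null)
  qed
  from bchoice[OF this] obtain K where K': "\<forall>M\<in>H. closed (K M) \<and> K M \<noteq> {} \<and> K M \<subseteq> {0<..<1} \<and>
     K M \<inter> M = {} \<and> (\<forall>I. open I \<longrightarrow> K M \<inter> I \<noteq> {} \<longrightarrow> measure lebesgue (K M \<inter> I) > 0)" ..
  have K: "closed (K M)" "K M \<noteq> {}" "K M \<subseteq> {0<..<1}" "K M \<inter> M = {}"
     "\<And>I. open I \<Longrightarrow> K M \<inter> I \<noteq> {} \<Longrightarrow> measure lebesgue (K M \<inter> I) > 0" if "M \<in> H" for M
    using bspec[OF K' that] by blast+
  obtain \<B> :: "real set set" where \<B>: "countable \<B>" "topological_basis \<B>"
    using ex_countable_basis by blast
  \<comment> \<open>The list \<open>w\<close> fixes the finitely many values at which \<open>f n\<close> need not belong to the avoidance set or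
    the width estimate is not yet available.\<close>
  define F where "F = (\<lambda>(M, I, w :: nat list). \<lambda>n.
     if n < length w then {w ! n} else {m. K M \<inter> I \<inter> G n m = {}})"
  define \<S> where "\<S> = F ` (H \<times> \<B> \<times> UNIV) \<inter> {S. \<forall>n. finite (S n) \<and> card (S n) \<le> slalom_width n}"
  show ?thesis
  proof (intro exI[of _ \<S>] conjI allI)
    have "|H \<times> \<B> \<times> (UNIV :: nat list set)| \<le>o cof_null"
    proof (rule Times_le_cof_null)
      show "|H| \<le>o cof_null" unfolding H(2) by (rule card_of_mono1) simp
      show "|\<B> \<times> (UNIV :: nat list set)| \<le>o cof_null"
        by (intro countable_le_cof_null countable_SIGMA \<B>) simp
    qed
    then show "|\<S>| \<le>o cof_null"
      unfolding \<S>_def by (rule subset_le_cof_null[OF image_le_cof_null Int_lower1])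
    show "\<forall>S\<in>\<S>. \<forall>n. finite (S n) \<and> card (S n) \<le> slalom_width n"
      unfolding \<S>_def by simp
    fix f :: "nat \<Rightarrow> nat"
    define N where "N = limsup (\<lambda>n. {0<..<1} \<inter> zero_digit (2 ^ Suc n) (f n))"
    have "N \<in> null_sets lebesgue" unfolding N_def by (rule null_limsup_zero_digit)
    then obtain M where M: "M \<in> H" "N \<subseteq> M" using H(1) unfolding cofinal_null_def by blast
    define V where "V k = (\<Union>n\<in>{k..}. G n (f n))" for k
    have oV: "open (V k)" for k unfolding V_def G_def by (intro open_UN ballI open_zero_digit)
    have KV: "K M \<inter> (\<Inter>k. V k) = {}"
    proof -
      have "K M \<inter> (\<Inter>k. V k) \<subseteq> N"
        using K(3)[OF M(1)] unfolding N_def V_def G_def limsup_INF_SUP by blast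
      with K(4)[OF M(1)] M(2) show ?thesis by blast
    qed
    \<comment> \<open>By the Baire category theorem not all \<open>V k\<close> are dense in \<open>K M\<close>.\<close>
    have "\<exists>k. \<not> K M \<subseteq> closure (K M \<inter> V k)"
    proof (rule ccontr)
      assume "\<not> ?thesis"
      then have "K M \<subseteq> closure (\<Inter>(range (\<lambda>k. K M \<inter> V k)))"
        by (intro Baire[OF K(1)[OF M(1)]]) (auto simp: oV openin_open_Int)
      also have "\<Inter>(range (\<lambda>k. K M \<inter> V k)) = {}" using KV by auto
      finally show False using K(2)[OF M(1)] by simp
    qed
    then obtain k x where x: "x \<in> K M" "x \<notin> closure (K M \<inter> V k)" by blast
    then have "x \<in> - closure (K M \<inter> V k)" by simp
    then obtain I where I: "I \<in> \<B>" "x \<in> I" "I \<subseteq> - closure (K M \<inter> V k)"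
      using topological_basisE[OF \<B>(2)] by (metis closed_closure open_Compl)
    have avoid: "K M \<inter> I \<inter> G n (f n) = {}" if "n \<ge> k" for n
      using I(3) that closure_subset[of "K M \<inter> V k"] unfolding V_def by blast
    define \<delta> where "\<delta> = measure lebesgue (K M \<inter> I)"
    have oI: "open I" using I(1) \<B>(2) topological_basis_open by blast
    have \<delta>: "\<delta> > 0" unfolding \<delta>_def using K(5)[OF M(1) oI] x I by blast
    have small: "\<delta> \<le> (1 - 1 / 2 ^ Suc n) ^ card T"
      if T: "finite T" "T \<subseteq> {m. K M \<inter> I \<inter> G n m = {}}" for n T
    proof -
      have "\<delta> \<le> measure lebesgue ({0..1} \<inter> no_zero_digit (2 ^ Suc n) T)"
        unfolding \<delta>_def
      proof (rule measure_mono_fmeasurable[OF _ _ lmeasurable_no_zero_digit])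
        show "K M \<inter> I \<subseteq> {0..1} \<inter> no_zero_digit (2 ^ Suc n) T"
          using T(2) K(3)[OF M(1)] by (auto simp: no_zero_digit_def G_def)
        show "K M \<inter> I \<in> sets lebesgue" using K(1)[OF M(1)] oI by auto
      qed
      also have "\<dots> \<le> (1 - 1 / real (2 ^ Suc n)) ^ card T"
        by (rule measure_no_zero_digit_le) (use T in auto)
      finally show ?thesis by simp
    qed
    have bound: "finite {m. K M \<inter> I \<inter> G n m = {}} \<and> card {m. K M \<inter> I \<inter> G n m = {}} \<le> slalom_width n"
      if n: "exp (- real n) < \<delta>" for n
    proof (rule ccontr)
      assume large: "\<not> ?thesis"
      obtain T where T: "finite T" "T \<subseteq> {m. K M \<inter> I \<inter> G n m = {}}" "card T = n * 2 ^ Suc n"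
      proof (cases "finite {m. K M \<inter> I \<inter> G n m = {}}")
        case True
        with large have "n * 2 ^ Suc n \<le> card {m. K M \<inter> I \<inter> G n m = {}}"
          unfolding slalom_width_def by linarith
        from obtain_subset_with_card_n[OF this] obtain T
          where "T \<subseteq> {m. K M \<inter> I \<inter> G n m = {}}" "card T = n * 2 ^ Suc n" "finite T" .
        with that show thesis by simp
      next
        case False
        from infinite_arbitrarily_large[OF this] obtain T
          where "finite T" "card T = n * 2 ^ Suc n" "T \<subseteq> {m. K M \<inter> I \<inter> G n m = {}}" by meson
        with that show thesis by simp
      qed
      have "\<delta> \<le> (1 - 1 / 2 ^ Suc n) ^ (n * 2 ^ Suc n)" using small[OF T(1,2)] T(3) by simp
      also have "\<dots> \<le> (exp (- (1 / 2 ^ Suc n))) ^ (n * 2 ^ Suc n)"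
      proof (rule power_mono)
        show "1 - 1 / 2 ^ Suc n \<le> exp (- (1 / 2 ^ Suc n :: real))"
          using exp_ge_add_one_self[of "- (1 / 2 ^ Suc n :: real)"] by simp
        have "(1::real) \<le> 2 ^ Suc n" by (rule one_le_power) simp
        then show "0 \<le> 1 - 1 / (2 ^ Suc n :: real)" by simp
      qed
      also have "\<dots> = exp (- real n)"
        unfolding exp_of_nat_mult[symmetric] by simp
      finally show False using n by simp
    qed
    obtain k' :: nat where "- ln \<delta> < real k'" using reals_Archimedean2 by blast
    then have k': "exp (- real n) < \<delta>" if "n \<ge> k'" for n
    proof -
      have "- real n < ln \<delta>" using \<open>- ln \<delta> < real k'\<close> that by linarith
      then have "exp (- real n) < exp (ln \<delta>)" by simp
      with \<delta> show ?thesis by simp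
    qed
    define l where "l = max k k'"
    define S where "S = F (M, I, map f [0..<l])"
    have S: "S n = (if n < l then {f n} else {m. K M \<inter> I \<inter> G n m = {}})" for n
      by (simp add: S_def F_def)
    have "S \<in> \<S>"
      unfolding \<S>_def
    proof
      show "S \<in> F ` (H \<times> \<B> \<times> UNIV)" unfolding S_def by (rule imageI) (simp add: M(1) I(1))
      show "S \<in> {S. \<forall>n. finite (S n) \<and> card (S n) \<le> slalom_width n}"
      proof (intro CollectI allI)
        fix n
        show "finite (S n) \<and> card (S n) \<le> slalom_width n"
        proof (cases "n < l")
          case True
          then show ?thesis by (simp add: S slalom_width_def)
        next
          case False
          then have "exp (- real n) < \<delta>" by (intro k') (simp add: l_def)
          from bound[OF this] False show ?thesis unfolding S by simp
        qed
      qed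
    qed
    moreover have "f n \<in> S n" for n
      using avoid[of n] unfolding S l_def by simp
    ultimately show "\<exists>S\<in>\<S>. \<forall>n. f n \<in> S n" by (intro bexI[of _ S] allI)
  qed
qed

section \<open>Moving finitely many small pieces off an open set of large measure\<close>

text \<open>Quasi-shifts are the functions with difference quotients between \<open>1/2\<close> and \<open>2\<close>.\<close>

definition quasi_shift_on :: "real set \<Rightarrow> (real \<Rightarrow> real) \<Rightarrow> bool" where
  "quasi_shift_on I u \<longleftrightarrow>
     (\<forall>s\<in>I. \<forall>t\<in>I. s \<le> t \<longrightarrow> (t - s) / 2 \<le> u t - u s \<and> u t - u s \<le> 2 * (t - s))"

lemma quasi_shift_on_subset: "quasi_shift_on I u \<Longrightarrow> J \<subseteq> I \<Longrightarrow> quasi_shift_on J u"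
  unfolding quasi_shift_on_def by blast

text \<open>
  The image of an interval of length \<open>l\<close> is too short to meet two components of \<open>zero_digit B m\<close>, and a
  component is too short to be met from both outer thirds of the interval. So all functions in \<open>F\<close>, which
  are close to each other, avoid the set on one of the outer thirds.
\<close>

lemma avoid_digit_one:
  fixes F :: "(real \<Rightarrow> real) set"
  assumes B: "B \<ge> 5" and l: "l > 0" "4 * l * real B ^ m \<le> 1" "l * real B ^ m * real B \<ge> 18"
    and qs: "\<And>u. u \<in> F \<Longrightarrow> quasi_shift_on {a..a + l} u"
    and close: "\<And>u v s. u \<in> F \<Longrightarrow> v \<in> F \<Longrightarrow> s \<in> {a..a + l} \<Longrightarrow> \<bar>u s - v s\<bar> * (real B ^ m * real B) \<le> 1"
  shows "\<exists>a'. a \<le> a' \<and> a' + l / 3 \<le> a + l \<and> (\<forall>s\<in>{a'..a' + l / 3}. \<forall>u\<in>F. u s \<notin> zero_digit B m)"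
proof (rule ccontr)
  assume contra: "\<not> ?thesis"
  have "\<not> (\<forall>s\<in>{a..a + l / 3}. \<forall>u\<in>F. u s \<notin> zero_digit B m)"
    using contra[unfolded not_ex, THEN spec, of a] l(1) by simp
  then obtain s u where s: "s \<in> {a..a + l / 3}" "u \<in> F" "u s \<in> zero_digit B m" by blast
  have "\<not> (\<forall>s\<in>{a + 2 * l / 3..a + 2 * l / 3 + l / 3}. \<forall>u\<in>F. u s \<notin> zero_digit B m)"
    using contra[unfolded not_ex, THEN spec, of "a + 2 * l / 3"] l(1) by simp
  then obtain t v where t: "t \<in> {a + 2 * l / 3..a + 2 * l / 3 + l / 3}" "v \<in> F" "v t \<in> zero_digit B m"
    by blast
  \<comment> \<open>The components met from the two thirds have indices \<open>z\<close> and \<open>w\<close>; both \<open>w \<le> z\<close> and \<open>w > z\<close> follow.\<close>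
  define D where "D = real B ^ m"
  have D: "D > 0" unfolding D_def using B by simp
  have Bp: "real B \<ge> 5" using B by simp
  obtain z :: int where z: "of_int z < D * u s" "D * u s < of_int z + 1 / real B"
    using s(3) unfolding zero_digit_def D_def by blast
  obtain w :: int where w: "of_int w < D * v t" "D * v t < of_int w + 1 / real B"
    using t(3) unfolding zero_digit_def D_def by blast
  have sI: "s \<in> {a..a + l}" and tI: "t \<in> {a..a + l}" using s(1) t(1) l(1) by auto
  have st: "l / 3 \<le> t - s" "t - s \<le> l" using s(1) t(1) by auto
  have q: "(t - s) / 2 \<le> u t - u s" "u t - u s \<le> 2 * (t - s)"
    using qs[OF s(2)] sI tI st l(1) unfolding quasi_shift_on_def by auto
  have "\<bar>u t - v t\<bar> * D \<le> 1 / real B"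
    using close[OF s(2) t(2) tI] Bp unfolding D_def by (simp add: field_simps)
  then have e: "\<bar>D * v t - D * u t\<bar> \<le> 1 / real B"
    using D by (metis abs_minus_commute abs_mult abs_of_pos mult.commute right_diff_distrib)
  have "l / 6 \<le> u t - u s" using q(1) st(1) by (simp add: field_simps)
  moreover have "u t - u s \<le> 2 * l" using q(2) mult_left_mono[OF st(2), of 2] by simp
  ultimately have "D * (l / 6) \<le> D * (u t - u s)" "D * (u t - u s) \<le> D * (2 * l)"
    using D by (simp_all add: mult_le_cancel_left_pos)
  then have d: "D * l / 6 \<le> D * u t - D * u s" "D * u t - D * u s \<le> 2 * (D * l)"
    by (simp_all add: algebra_simps)
  have l2: "4 * (D * l) \<le> 1" using l(2) unfolding D_def by (simp add: algebra_simps)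
  have l3: "D * l \<ge> 18 / real B" using l(3) Bp unfolding D_def by (simp add: field_simps)
  have b5: "1 / real B \<le> 1 / 5" using Bp by (simp add: field_simps)
  have b0: "1 / real B > 0" using Bp by simp
  have l3': "D * l \<ge> 18 * (1 / real B)" using l3 by simp
  have "of_int w - of_int z < (1::real)" using w z e d l2 b5 by linarith
  then have "w \<le> z" by linarith
  moreover have "of_int w - of_int z > (0::real)" using w z e d l3' b0 by linarith
  ultimately show False by linarith
qed

text \<open>
  Treating the members of \<open>Q\<close> one after the other divides the length by \<open>3\<close> each time; a base
  \<open>B \<ge> 72 * 3 ^ N\<close> keeps all intermediate lengths \<open>l\<close> in the range \<open>l * B ^ Suc m \<ge> 18\<close>.
\<close>

lemma avoid_digit:
  assumes Q: "finite Q" "card Q \<le> N" and B: "B \<ge> 72 * 3 ^ N"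
    and l: "l * (4 * real B ^ m) = 1" and l': "l' * (4 * real B ^ Suc m) = 1"
    and qs: "\<And>F u. F \<in> Q \<Longrightarrow> u \<in> F \<Longrightarrow> quasi_shift_on {a..a + l} u"
    and close: "\<And>F u v s. F \<in> Q \<Longrightarrow> u \<in> F \<Longrightarrow> v \<in> F \<Longrightarrow> s \<in> {a..a + l} \<Longrightarrow> \<bar>u s - v s\<bar> * real B ^ Suc m \<le> 1"
  shows "\<exists>a'. a \<le> a' \<and> a' + l' \<le> a + l \<and> (\<forall>s\<in>{a'..a' + l'}. \<forall>F\<in>Q. \<forall>u\<in>F. u s \<notin> zero_digit B m)"
proof -
  have "(1::nat) \<le> 3 ^ N" by simp
  then have B5: "B \<ge> 72" using B by linarith
  have D: "real B ^ m > 0" using B5 by simp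
  have l0: "l > 0" using l D by (smt (verit) mult_nonneg_nonpos2 mult_nonneg_nonneg)
  have RB: "real B \<ge> 72 * 3 ^ N" using B by (metis of_nat_le_iff of_nat_mult of_nat_numeral of_nat_power)
  have key: "\<exists>a'. a \<le> a' \<and> a' + l / 3 ^ card Q' \<le> a + l \<and>
     (\<forall>s\<in>{a'..a' + l / 3 ^ card Q'}. \<forall>F\<in>Q'. \<forall>u\<in>F. u s \<notin> zero_digit B m)" if "finite Q'" "Q' \<subseteq> Q" for Q'
    using that
  proof (induction Q' rule: finite_induct)
    case empty
    show ?case by (intro exI[of _ a]) simp
  next
    case (insert F Q')
    define l1 where "l1 = l / 3 ^ card Q'"
    obtain a1 where a1: "a \<le> a1" "a1 + l1 \<le> a + l"
      "\<And>s F u. s \<in> {a1..a1 + l1} \<Longrightarrow> F \<in> Q' \<Longrightarrow> u \<in> F \<Longrightarrow> u s \<notin> zero_digit B m"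
      using insert unfolding l1_def by blast
    have FQ: "F \<in> Q" using insert.prems by blast
    have card: "Suc (card Q') \<le> N"
      using card_mono[OF Q(1) insert.prems] insert.hyps Q(2) by simp
    have l1p: "l1 > 0" unfolding l1_def using l0 by simp
    have l1l: "l1 \<le> l" unfolding l1_def using l0 by (simp add: divide_le_eq one_le_power)
    have sub: "{a1..a1 + l1} \<subseteq> {a..a + l}" using a1 by auto
    have "\<exists>a'. a1 \<le> a' \<and> a' + l1 / 3 \<le> a1 + l1 \<and> (\<forall>s\<in>{a'..a' + l1 / 3}. \<forall>u\<in>F. u s \<notin> zero_digit B m)"
    proof (rule avoid_digit_one)
      show "B \<ge> 5" using B5 by simp
      show "l1 > 0" by fact
      show "4 * l1 * real B ^ m \<le> 1"
      proof -
        have "4 * l1 * real B ^ m \<le> 4 * l * real B ^ m" using l1l D by simp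
        also have "\<dots> = 1" using l by (simp add: algebra_simps)
        finally show ?thesis .
      qed
      have "(3::real) ^ card Q' \<le> 3 ^ N" using card by (intro power_increasing) auto
      then have "72 * 3 ^ card Q' \<le> real B" using RB by linarith
      then have "18 \<le> real B / (4 * 3 ^ card Q')" by (simp add: field_simps)
      also have "\<dots> = l1 * real B ^ m * real B"
        unfolding l1_def using l by (simp add: field_simps)
      finally show "l1 * real B ^ m * real B \<ge> 18" .
      show "quasi_shift_on {a1..a1 + l1} u" if "u \<in> F" for u
        using quasi_shift_on_subset[OF qs[OF FQ that] sub] .
      show "\<bar>u s - v s\<bar> * (real B ^ m * real B) \<le> 1" if "u \<in> F" "v \<in> F" "s \<in> {a1..a1 + l1}" for u v s
        using close[OF FQ that(1,2)] that(3) sub by (simp add: mult.commute subset_iff)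
    qed
    then obtain a' where a': "a1 \<le> a'" "a' + l1 / 3 \<le> a1 + l1"
      "\<And>s u. s \<in> {a'..a' + l1 / 3} \<Longrightarrow> u \<in> F \<Longrightarrow> u s \<notin> zero_digit B m" by blast
    have eq: "l / 3 ^ card (insert F Q') = l1 / 3" using insert.hyps by (simp add: l1_def)
    show ?case
      unfolding eq
    proof (intro exI[of _ a'] conjI ballI)
      show "a \<le> a'" "a' + l1 / 3 \<le> a + l" using a' a1 by linarith+
      fix s F' u assume s: "s \<in> {a'..a' + l1 / 3}" "F' \<in> insert F Q'" "u \<in> F'"
      then have "s \<in> {a1..a1 + l1}" using a' by auto
      then show "u s \<notin> zero_digit B m" using s a'(3) a1(3) by blast
    qed
  qed
  obtain a' where a': "a \<le> a'" "a' + l / 3 ^ card Q \<le> a + l"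
    "\<And>s F u. s \<in> {a'..a' + l / 3 ^ card Q} \<Longrightarrow> F \<in> Q \<Longrightarrow> u \<in> F \<Longrightarrow> u s \<notin> zero_digit B m"
    using key[OF Q(1) subset_refl] by blast
  have "l' * real B * (4 * real B ^ m) = l * (4 * real B ^ m)"
    using l l' by (simp add: algebra_simps)
  then have "l' * real B = l" using B5 by simp
  then have "l' = l / real B" using B5 by (simp add: field_simps)
  also have "\<dots> \<le> l / 3 ^ card Q"
  proof -
    have "(3::real) ^ card Q \<le> 3 ^ N" using Q(2) by (intro power_increasing) auto
    also have "\<dots> \<le> 72 * 3 ^ N" by simp
    finally have "3 ^ card Q \<le> real B" using RB by linarith
    then show ?thesis using l0 B5 by (intro divide_left_mono) auto
  qed
  finally have "l' \<le> l / 3 ^ card Q" .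
  then show ?thesis using a' by (intro exI[of _ a']) force
qed

lemma avoid_digits:
  assumes Q: "finite Q" "card Q \<le> N" and B: "B \<ge> 72 * 3 ^ N"
    and qs: "\<And>F u. F \<in> Q \<Longrightarrow> u \<in> F \<Longrightarrow> quasi_shift_on {a..a + 1 / (4 * real B ^ m)} u"
    and close: "\<And>F u v s. F \<in> Q \<Longrightarrow> u \<in> F \<Longrightarrow> v \<in> F \<Longrightarrow> s \<in> {a..a + 1 / (4 * real B ^ m)} \<Longrightarrow>
      \<bar>u s - v s\<bar> * real B ^ (m + k) \<le> 1"
  shows "\<exists>a'. a \<le> a' \<and> a' + 1 / (4 * real B ^ (m + k)) \<le> a + 1 / (4 * real B ^ m) \<and>
    (\<forall>s\<in>{a'..a' + 1 / (4 * real B ^ (m + k))}. \<forall>F\<in>Q. \<forall>u\<in>F. \<forall>j\<in>{m..<m + k}. u s \<notin> zero_digit B j)"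
  using close
proof (induction k)
  case 0
  show ?case by (intro exI[of _ a]) simp
next
  case (Suc k)
  have "(1::nat) \<le> 3 ^ N" by simp
  then have B1: "B \<ge> 1" using B by linarith
  have "\<bar>u s - v s\<bar> * real B ^ (m + k) \<le> 1" if "F \<in> Q" "u \<in> F" "v \<in> F" "s \<in> {a..a + 1 / (4 * real B ^ m)}" for F u v s
  proof -
    have "\<bar>u s - v s\<bar> * real B ^ (m + k) \<le> \<bar>u s - v s\<bar> * real B ^ (m + Suc k)"
      using B1 by (intro mult_left_mono power_increasing) auto
    also have "\<dots> \<le> 1" by (rule Suc.prems[OF that])
    finally show ?thesis .
  qed
  then have "\<exists>a'. a \<le> a' \<and> a' + 1 / (4 * real B ^ (m + k)) \<le> a + 1 / (4 * real B ^ m) \<and>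
    (\<forall>s\<in>{a'..a' + 1 / (4 * real B ^ (m + k))}. \<forall>F\<in>Q. \<forall>u\<in>F. \<forall>j\<in>{m..<m + k}. u s \<notin> zero_digit B j)"
    by (rule Suc.IH)
  then obtain a1 where a1: "a \<le> a1" "a1 + 1 / (4 * real B ^ (m + k)) \<le> a + 1 / (4 * real B ^ m)"
    "\<And>s F u j. s \<in> {a1..a1 + 1 / (4 * real B ^ (m + k))} \<Longrightarrow> F \<in> Q \<Longrightarrow> u \<in> F \<Longrightarrow> j \<in> {m..<m + k} \<Longrightarrow> u s \<notin> zero_digit B j"
    by blast
  have sub: "{a1..a1 + 1 / (4 * real B ^ (m + k))} \<subseteq> {a..a + 1 / (4 * real B ^ m)}" using a1 by auto
  have "\<exists>a'. a1 \<le> a' \<and> a' + 1 / (4 * real B ^ (m + Suc k)) \<le> a1 + 1 / (4 * real B ^ (m + k)) \<and>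
     (\<forall>s\<in>{a'..a' + 1 / (4 * real B ^ (m + Suc k))}. \<forall>F\<in>Q. \<forall>u\<in>F. u s \<notin> zero_digit B (m + k))"
  proof (rule avoid_digit[OF Q B])
    show "1 / (4 * real B ^ (m + k)) * (4 * real B ^ (m + k)) = 1"
      "1 / (4 * real B ^ (m + Suc k)) * (4 * real B ^ Suc (m + k)) = 1" using B1 by auto
    show "quasi_shift_on {a1..a1 + 1 / (4 * real B ^ (m + k))} u" if "F \<in> Q" "u \<in> F" for F u
      using quasi_shift_on_subset[OF qs[OF that] sub] .
    show "\<bar>u s - v s\<bar> * real B ^ Suc (m + k) \<le> 1"
      if "F \<in> Q" "u \<in> F" "v \<in> F" "s \<in> {a1..a1 + 1 / (4 * real B ^ (m + k))}" for F u v s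
      using Suc.prems[OF that(1-3)] that(4) sub by auto
  qed
  then obtain a' where a': "a1 \<le> a'" "a' + 1 / (4 * real B ^ (m + Suc k)) \<le> a1 + 1 / (4 * real B ^ (m + k))"
    "\<And>s F u. s \<in> {a'..a' + 1 / (4 * real B ^ (m + Suc k))} \<Longrightarrow> F \<in> Q \<Longrightarrow> u \<in> F \<Longrightarrow> u s \<notin> zero_digit B (m + k)"
    by blast
  show ?case
  proof (intro exI[of _ a'] conjI ballI)
    show "a \<le> a'" "a' + 1 / (4 * real B ^ (m + Suc k)) \<le> a + 1 / (4 * real B ^ m)" using a' a1 by linarith+
    fix s F u j assume s: "s \<in> {a'..a' + 1 / (4 * real B ^ (m + Suc k))}" "F \<in> Q" "u \<in> F" "j \<in> {m..<m + Suc k}"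
    then have "s \<in> {a1..a1 + 1 / (4 * real B ^ (m + k))}" using a' by auto
    moreover have "j = m + k \<or> j \<in> {m..<m + k}" using s(4) by auto
    ultimately show "u s \<notin> zero_digit B j" using s a'(3) a1(3) by blast
  qed
qed

text \<open>
  For at most \<open>N\<close> sets of quasi-shifts on an interval of length \<open>\<tau>\<close>, each of diameter at most \<open>\<rho>\<close> in the
  uniform distance, there is a subinterval of length \<open>\<tau>'\<close> on which all the functions avoid \<open>V\<close>.
\<close>

definition escapable :: "nat \<Rightarrow> real \<Rightarrow> real set \<Rightarrow> real \<Rightarrow> real \<Rightarrow> bool" where
  "escapable N \<tau> V \<tau>' \<rho> \<longleftrightarrow>
    (\<forall>a Q. finite Q \<longrightarrow> card Q \<le> N \<longrightarrow> (\<forall>F\<in>Q. \<forall>u\<in>F. quasi_shift_on {a..a + \<tau>} u) \<longrightarrow>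
       (\<forall>F\<in>Q. \<forall>u\<in>F. \<forall>v\<in>F. \<forall>s\<in>{a..a + \<tau>}. \<bar>u s - v s\<bar> \<le> \<rho>) \<longrightarrow>
       (\<exists>a'. a \<le> a' \<and> a' + \<tau>' \<le> a + \<tau> \<and> (\<forall>s\<in>{a'..a' + \<tau>'}. \<forall>F\<in>Q. \<forall>u\<in>F. u s \<notin> V)))"

lemma measure_Diff_zero_digits_le:
  fixes R :: nat
  assumes "B \<ge> 1"
  shows "measure lebesgue ({- real R..real R} - (\<Union>j\<in>{m..<m + k}. zero_digit B j)) \<le> 2 * real R * (1 - 1 / real B) ^ k"
proof -
  define T where "T = {0..1} \<inter> no_zero_digit B {m..<m + k}"
  have Tm: "T \<in> lmeasurable" unfolding T_def by (rule lmeasurable_no_zero_digit)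
  have Tle: "measure lebesgue T \<le> (1 - 1 / real B) ^ k"
    using measure_no_zero_digit_le[OF assms, of "{m..<m + k}"] unfolding T_def by simp
  define J where "J = {- int R..<int R}"
  have sub: "{- real R..real R} - (\<Union>j\<in>{m..<m + k}. zero_digit B j) \<subseteq> (\<Union>i\<in>J. (+) (of_int i) ` T) \<union> {real R}"
  proof
    fix y assume y: "y \<in> {- real R..real R} - (\<Union>j\<in>{m..<m + k}. zero_digit B j)"
    show "y \<in> (\<Union>i\<in>J. (+) (of_int i) ` T) \<union> {real R}"
    proof (cases "y = real R")
      case False
      define i where "i = \<lfloor>y\<rfloor>"
      have i: "of_int i \<le> y" "y < of_int i + 1" unfolding i_def by linarith+
      have "i \<in> J" unfolding J_def i_def using y False by (auto simp: floor_less_iff le_floor_iff)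
      moreover have "(y - of_int i) + of_int i \<in> no_zero_digit B {m..<m + k}"
        using y by (simp add: no_zero_digit_def)
      then have "y - of_int i \<in> T"
        unfolding T_def no_zero_digit_add_int using i by auto
      then have "y \<in> (+) (of_int i) ` T" by (intro image_eqI[of _ _ "y - of_int i"]) auto
      ultimately show ?thesis by blast
    qed simp
  qed
  have m1: "(+) (of_int i) ` T \<in> lmeasurable" for i :: int
    using Tm by (rule measurable_translation)
  have mR: "{real R} \<in> lmeasurable" by (rule lmeasurable_compact) simp
  have fin: "finite J" unfolding J_def by simp
  have "measure lebesgue ({- real R..real R} - (\<Union>j\<in>{m..<m + k}. zero_digit B j))
    \<le> measure lebesgue ((\<Union>i\<in>J. (+) (of_int i) ` T) \<union> {real R})"
  proof (rule measure_mono_fmeasurable[OF sub])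
    show "{- real R..real R} - (\<Union>j\<in>{m..<m + k}. zero_digit B j) \<in> sets lebesgue"
      using open_UN[of "{m..<m + k}" "zero_digit B"] open_zero_digit by auto
    show "(\<Union>i\<in>J. (+) (of_int i) ` T) \<union> {real R} \<in> lmeasurable"
      by (intro fmeasurable.Un fmeasurable.finite_UN fin m1 mR)
  qed
  also have "\<dots> \<le> measure lebesgue (\<Union>i\<in>J. (+) (of_int i) ` T) + measure lebesgue {real R}"
    by (intro measure_Un_le fmeasurableD fmeasurable.finite_UN fin m1 mR)
  also have "measure lebesgue {real R} = 0"
    by (rule negligible_imp_measure0) simp
  also have "measure lebesgue (\<Union>i\<in>J. (+) (of_int i) ` T) \<le> (\<Sum>i\<in>J. measure lebesgue ((+) (of_int i) ` T))"
    by (intro measure_UNION_le fin fmeasurableD[OF m1])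
  also have "\<dots> = (\<Sum>i\<in>J. measure lebesgue T)"
    by (intro sum.cong refl measure_translation)
  also have "\<dots> = 2 * real R * measure lebesgue T" by (simp add: J_def)
  also have "\<dots> \<le> 2 * real R * (1 - 1 / real B) ^ k" by (intro mult_left_mono Tle) auto
  finally show ?thesis by simp
qed

text \<open>
  Here \<open>V\<close> consists, up to countably many points, of the reals with a zero among \<open>k\<close> consecutive
  digits in a base depending only on \<open>N\<close>.
  The length \<open>\<tau>\<close> determines the position of the first of these digits, and their number \<open>k\<close> makes the
  complement small.
\<close>

lemma ex_escapable:
  fixes R :: nat
  assumes \<tau>: "\<tau> > 0" and \<eta>: "\<eta> > 0"
  shows "\<exists>V \<tau>' \<rho>. open V \<and> \<tau>' > 0 \<and> \<rho> > 0 \<and> measure lebesgue ({- real R..real R} - V) \<le> \<eta> \<and> escapable N \<tau> V \<tau>' \<rho>"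
proof -
  define B :: nat where "B = 72 * 3 ^ N"
  have "(1::nat) \<le> 3 ^ N" by simp
  then have B72: "B \<ge> 72" unfolding B_def by linarith
  have Bp: "real B ^ j > 0" for j using B72 by simp
  obtain m where m: "1 / (4 * real B ^ m) \<le> \<tau>"
  proof -
    obtain m where "(1 / real B) ^ m < \<tau>"
      using real_arch_pow_inv[OF \<tau>, of "1 / real B"] B72 by auto
    moreover have "1 / (4 * real B ^ m) \<le> (1 / real B) ^ m" using Bp[of m] by (simp add: field_simps)
    ultimately show thesis by (intro that[of m]) linarith
  qed
  obtain k where k: "2 * real R * (1 - 1 / real B) ^ k \<le> \<eta>"
  proof -
    have "\<eta> / (2 * real R + 1) > 0" using \<eta> by simp
    then obtain k where k: "(1 - 1 / real B) ^ k < \<eta> / (2 * real R + 1)"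
      using real_arch_pow_inv[of "\<eta> / (2 * real R + 1)" "1 - 1 / real B"] B72 by auto
    have "0 \<le> (1 - 1 / real B) ^ k" using B72 by simp
    then have "2 * real R * (1 - 1 / real B) ^ k \<le> (2 * real R + 1) * (1 - 1 / real B) ^ k"
      by (intro mult_right_mono) auto
    also have "\<dots> \<le> \<eta>" using k by (simp add: field_simps)
    finally show thesis by (rule that)
  qed
  define V where "V = (\<Union>j\<in>{m..<m + k}. zero_digit B j)"
  have "escapable N \<tau> V (1 / (4 * real B ^ (m + k))) (1 / real B ^ (m + k))"
    unfolding escapable_def
  proof (intro allI impI)
    fix a and Q :: "(real \<Rightarrow> real) set set"
    assume Q: "finite Q" "card Q \<le> N" "\<forall>F\<in>Q. \<forall>u\<in>F. quasi_shift_on {a..a + \<tau>} u"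
      "\<forall>F\<in>Q. \<forall>u\<in>F. \<forall>v\<in>F. \<forall>s\<in>{a..a + \<tau>}. \<bar>u s - v s\<bar> \<le> 1 / real B ^ (m + k)"
    have sub: "{a..a + 1 / (4 * real B ^ m)} \<subseteq> {a..a + \<tau>}" using m by auto
    have "\<exists>a'. a \<le> a' \<and> a' + 1 / (4 * real B ^ (m + k)) \<le> a + 1 / (4 * real B ^ m) \<and>
      (\<forall>s\<in>{a'..a' + 1 / (4 * real B ^ (m + k))}. \<forall>F\<in>Q. \<forall>u\<in>F. \<forall>j\<in>{m..<m + k}. u s \<notin> zero_digit B j)"
    proof (rule avoid_digits[OF Q(1,2)])
      show "72 * 3 ^ N \<le> B" by (simp add: B_def)
      show "quasi_shift_on {a..a + 1 / (4 * real B ^ m)} u" if "F \<in> Q" "u \<in> F" for F u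
        using quasi_shift_on_subset[OF _ sub] Q(3) that by blast
      show "\<bar>u s - v s\<bar> * real B ^ (m + k) \<le> 1"
        if "F \<in> Q" "u \<in> F" "v \<in> F" "s \<in> {a..a + 1 / (4 * real B ^ m)}" for F u v s
      proof -
        have "\<bar>u s - v s\<bar> \<le> 1 / real B ^ (m + k)" using Q(4) that sub by blast
        then show ?thesis using Bp[of "m + k"] by (simp add: pos_le_divide_eq)
      qed
    qed
    then obtain a' where "a \<le> a'" "a' + 1 / (4 * real B ^ (m + k)) \<le> a + 1 / (4 * real B ^ m)"
      "\<forall>s\<in>{a'..a' + 1 / (4 * real B ^ (m + k))}. \<forall>F\<in>Q. \<forall>u\<in>F. \<forall>j\<in>{m..<m + k}. u s \<notin> zero_digit B j"
      by blast
    then show "\<exists>a'. a \<le> a' \<and> a' + 1 / (4 * real B ^ (m + k)) \<le> a + \<tau> \<and>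
       (\<forall>s\<in>{a'..a' + 1 / (4 * real B ^ (m + k))}. \<forall>F\<in>Q. \<forall>u\<in>F. u s \<notin> V)"
      using m unfolding V_def by (intro exI[of _ a']) auto
  qed
  moreover have "open V" unfolding V_def by (intro open_UN ballI open_zero_digit)
  moreover have "measure lebesgue ({- real R..real R} - V) \<le> \<eta>"
    using measure_Diff_zero_digits_le[of B R m k] k B72 unfolding V_def by linarith
  ultimately show ?thesis using Bp[of "m + k"]
    by (intro exI[of _ V] exI[of _ "1 / (4 * real B ^ (m + k))"] exI[of _ "1 / real B ^ (m + k)"]) simp
qed

section \<open>A compact null set hit by families of quasi-shifts\<close>

text \<open>Iterated escape: the intervals \<open>{a n..a n + T n}\<close> are nested and \<open>s\<close> lies in all of them.\<close>

lemma ex_common_escape: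
  fixes V :: "nat \<Rightarrow> real set" and T :: "nat \<Rightarrow> real" and Q :: "nat \<Rightarrow> (real \<Rightarrow> real) set set"
  assumes T: "\<And>n. T n > 0"
    and esc: "\<And>n. \<exists>\<rho>. escapable (N n) (T n) (V n) (T (Suc n)) \<rho> \<and>
       (\<forall>F\<in>Q n. \<forall>u\<in>F. \<forall>v\<in>F. \<forall>s\<in>{a0..a0 + T 0}. \<bar>u s - v s\<bar> \<le> \<rho>)"
    and Q: "\<And>n. finite (Q n)" "\<And>n. card (Q n) \<le> N n"
    and qs: "\<And>n F u. F \<in> Q n \<Longrightarrow> u \<in> F \<Longrightarrow> quasi_shift_on {a0..a0 + T 0} u"
  shows "\<exists>s\<in>{a0..a0 + T 0}. \<forall>n. \<forall>F\<in>Q n. \<forall>u\<in>F. u s \<notin> V n"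
proof -
  define P where "P n a \<longleftrightarrow> a0 \<le> a \<and> a + T n \<le> a0 + T 0" for n a
  define R where "R n a a' \<longleftrightarrow> a \<le> a' \<and> a' + T (Suc n) \<le> a + T n \<and>
     (\<forall>s\<in>{a'..a' + T (Suc n)}. \<forall>F\<in>Q n. \<forall>u\<in>F. u s \<notin> V n)" for n a a'
  have "\<exists>a'. P (Suc n) a' \<and> R n a a'" if "P n a" for n a
  proof -
    obtain \<rho> where \<rho>: "escapable (N n) (T n) (V n) (T (Suc n)) \<rho>"
       "\<forall>F\<in>Q n. \<forall>u\<in>F. \<forall>v\<in>F. \<forall>s\<in>{a0..a0 + T 0}. \<bar>u s - v s\<bar> \<le> \<rho>"
      using esc by blast
    have sub: "{a..a + T n} \<subseteq> {a0..a0 + T 0}" using that unfolding P_def by auto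
    have "\<exists>a'. R n a a'"
      unfolding R_def
    proof (rule \<rho>(1)[unfolded escapable_def, rule_format])
      show "finite (Q n)" "card (Q n) \<le> N n" by (rule Q)+
      show "quasi_shift_on {a..a + T n} u" if "F \<in> Q n" "u \<in> F" for F u
        using quasi_shift_on_subset[OF qs[OF that] sub] .
      show "\<bar>u s - v s\<bar> \<le> \<rho>" if "F \<in> Q n" "u \<in> F" "v \<in> F" "s \<in> {a..a + T n}" for F u v s
        using \<rho>(2) that sub by blast
    qed
    then obtain a' where "R n a a'" by blast
    moreover have "P (Suc n) a'" using that \<open>R n a a'\<close> unfolding P_def R_def by linarith
    ultimately show ?thesis by blast
  qed
  moreover have "\<exists>a. P 0 a" by (intro exI[of _ a0]) (simp add: P_def)
  ultimately obtain a where a: "\<And>n. P n (a n)" "\<And>n. R n (a n) (a (Suc n))"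
    using dependent_nat_choice[of P R] by blast
  have mono: "incseq a" by (rule incseq_SucI) (use a(2) in \<open>auto simp: R_def\<close>)
  have dec: "decseq (\<lambda>n. a n + T n)" by (rule decseq_SucI) (use a(2) in \<open>auto simp: R_def\<close>)
  have le: "a n \<le> a m + T m" for n m
  proof -
    have "a n \<le> a (max n m)" using mono by (simp add: incseqD)
    also have "\<dots> \<le> a (max n m) + T (max n m)" using T[of "max n m"] by simp
    also have "\<dots> \<le> a m + T m" using decseqD[OF dec, of m "max n m"] by simp
    finally show ?thesis .
  qed
  define s where "s = (SUP n. a n)"
  have bdd: "bdd_above (range a)" using le[of _ 0] by (intro bdd_aboveI[of _ "a 0 + T 0"]) auto
  have s: "s \<in> {a n..a n + T n}" for n
    unfolding s_def using cSUP_upper[OF _ bdd] cSUP_least[of UNIV a "a n + T n"] le by auto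
  show ?thesis
  proof (intro bexI[of _ s] allI ballI)
    show "s \<in> {a0..a0 + T 0}" using s[of 0] a(1)[of 0] unfolding P_def by auto
    fix n F u assume "F \<in> Q n" "u \<in> F"
    then show "u s \<notin> V n" using a(2)[of n] s[of "Suc n"] unfolding R_def by blast
  qed
qed

text \<open>
  The sets \<open>V n\<close>, the lengths \<open>T n\<close> and the tolerances \<open>\<rho> n\<close> are chosen first and do not depend on the
  points. Then \<open>X\<close> is cut at stage \<open>n\<close> into pieces \<open>pc n i\<close> of size \<open>\<rho> n\<close>, and each slalom gets one
  parameter that keeps all the pieces it selects out of all \<open>V n\<close>.
\<close>

theorem ex_compact_null_hit_by_shifts:
  fixes g :: "real \<Rightarrow> 'p \<Rightarrow> real" and R :: nat
  assumes \<sigma>: "\<sigma> > 0"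
    and qs: "\<And>p. p \<in> X \<Longrightarrow> quasi_shift_on {0..\<sigma>} (\<lambda>s. g s p)"
    and small: "\<And>\<rho>. \<rho> > 0 \<Longrightarrow> \<exists>\<P>. countable \<P> \<and> X \<subseteq> \<Union>\<P> \<and>
      (\<forall>P\<in>\<P>. \<forall>p\<in>P \<inter> X. \<forall>q\<in>P \<inter> X. \<forall>s\<in>{0..\<sigma>}. \<bar>g s p - g s q\<bar> \<le> \<rho>)"
    and bd: "\<And>p s. p \<in> X \<Longrightarrow> s \<in> {0..\<sigma>} \<Longrightarrow> \<bar>g s p\<bar> \<le> real R"
  shows "\<exists>C A. compact C \<and> negligible C \<and> A \<subseteq> {0..\<sigma>} \<and> |A| \<le>o cof_null \<and> (\<forall>p\<in>X. \<exists>s\<in>A. g s p \<in> C)"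
proof -
  define Good where "Good n \<tau> \<tau>' V \<rho> \<longleftrightarrow> open V \<and> \<tau>' > 0 \<and> \<rho> > 0 \<and>
    measure lebesgue ({- real R..real R} - V) \<le> (1/2) ^ n \<and> escapable (slalom_width n) \<tau> V \<tau>' \<rho>"
    for n \<tau> \<tau>' V \<rho>
  define P where "P n \<tau> \<longleftrightarrow> \<tau> > 0 \<and> (n = 0 \<longrightarrow> \<tau> = \<sigma>)" for n :: nat and \<tau> :: real
  have "\<exists>\<tau>'. P (Suc n) \<tau>' \<and> (\<exists>V \<rho>. Good n \<tau> \<tau>' V \<rho>)" if "P n \<tau>" for n \<tau>
  proof -
    have "\<tau> > 0" "(1/2) ^ n > (0::real)" using that unfolding P_def by auto
    from ex_escapable[OF this, of R "slalom_width n"] obtain V \<tau>' \<rho> where "Good n \<tau> \<tau>' V \<rho>"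
      unfolding Good_def by blast
    moreover from this have "P (Suc n) \<tau>'" unfolding Good_def P_def by simp
    ultimately show ?thesis by blast
  qed
  moreover have "\<exists>\<tau>. P 0 \<tau>" unfolding P_def using \<sigma> by auto
  ultimately obtain T where T: "\<And>n. P n (T n)" "\<And>n. \<exists>V \<rho>. Good n (T n) (T (Suc n)) V \<rho>"
    using dependent_nat_choice[of P "\<lambda>n \<tau> \<tau>'. \<exists>V \<rho>. Good n \<tau> \<tau>' V \<rho>"] by blast
  then obtain V \<rho> where V: "\<And>n. Good n (T n) (T (Suc n)) (V n) (\<rho> n)" by metis
  have T0: "T 0 = \<sigma>" and Tpos: "\<And>n. T n > 0" using T(1) unfolding P_def by auto
  define C where "C = {- real R..real R} - (\<Union>n. V n)"
  have oV: "open (V n)" for n using V unfolding Good_def by blast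
  have cC: "compact C" unfolding C_def by (intro compact_diff open_UN ballI oV) simp
  have "negligible C"
  proof -
    have "measure lebesgue C \<le> (1/2) ^ n" for n
    proof -
      have "measure lebesgue C \<le> measure lebesgue ({- real R..real R} - V n)"
      proof (rule measure_mono_fmeasurable)
        show "C \<subseteq> {- real R..real R} - V n" unfolding C_def by blast
        show "C \<in> sets lebesgue" by (rule fmeasurableD[OF lmeasurable_compact[OF cC]])
        show "{- real R..real R} - V n \<in> lmeasurable"
          by (intro lmeasurable_compact compact_diff oV) simp
      qed
      also have "\<dots> \<le> (1/2) ^ n" using V[of n] unfolding Good_def by blast
      finally show ?thesis .
    qed
    moreover have "(\<lambda>n. (1/2) ^ n :: real) \<longlonglongrightarrow> 0" by (rule LIMSEQ_realpow_zero) auto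
    ultimately have "measure lebesgue C \<le> 0"
      using LIMSEQ_le_const[of "\<lambda>n. (1/2) ^ n" 0 "measure lebesgue C"] by blast
    then have "measure lebesgue C = 0" using measure_nonneg[of lebesgue C] by linarith
    then show ?thesis using lmeasurable_compact[OF cC] by (simp add: negligible_iff_measure)
  qed
  define pieces where "pieces n pc \<longleftrightarrow> X \<subseteq> (\<Union>i. pc i) \<and>
    (\<forall>i. \<forall>p\<in>pc i \<inter> X. \<forall>q\<in>pc i \<inter> X. \<forall>s\<in>{0..\<sigma>}. \<bar>g s p - g s q\<bar> \<le> \<rho> n)"
    for n and pc :: "nat \<Rightarrow> 'p set"
  have "\<exists>pc. pieces n pc" for n
  proof -
    have "\<rho> n > 0" using V unfolding Good_def by blast
    from small[OF this] obtain \<P> where \<P>: "countable \<P>" "X \<subseteq> \<Union>\<P>"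
      "\<forall>P\<in>\<P>. \<forall>p\<in>P \<inter> X. \<forall>q\<in>P \<inter> X. \<forall>s\<in>{0..\<sigma>}. \<bar>g s p - g s q\<bar> \<le> \<rho> n"
      by (elim exE conjE)
    show ?thesis
    proof (cases "\<P> = {}")
      case True
      then show ?thesis unfolding pieces_def using \<P>(2) by (intro exI[of _ "\<lambda>_. {}"]) auto
    next
      case False
      then have "range (from_nat_into \<P>) = \<P>" using \<P>(1) by simp
      with \<P>(2) have "X \<subseteq> (\<Union>i. from_nat_into \<P> i)" by simp
      moreover note bspec[OF \<P>(3) from_nat_into[OF False]]
      ultimately have "pieces n (from_nat_into \<P>)" unfolding pieces_def by (intro conjI allI)
      then show ?thesis by blast
    qed
  qed
  then obtain pc where pieces: "\<And>n. pieces n (pc n)" by metis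
  have pc: "X \<subseteq> (\<Union>i. pc n i)"
    "\<And>i p q s. p \<in> pc n i \<inter> X \<Longrightarrow> q \<in> pc n i \<inter> X \<Longrightarrow> s \<in> {0..\<sigma>} \<Longrightarrow> \<bar>g s p - g s q\<bar> \<le> \<rho> n" for n
    using pieces[of n] unfolding pieces_def by blast+
  obtain \<S> :: "(nat \<Rightarrow> nat set) set" where \<S>: "|\<S>| \<le>o cof_null"
    "\<forall>S\<in>\<S>. \<forall>n. finite (S n) \<and> card (S n) \<le> slalom_width n"
    "\<forall>f. \<exists>S\<in>\<S>. \<forall>n. f n \<in> S n"
    using slaloms_of_cofinality by blast
  have "\<exists>s\<in>{0..\<sigma>}. \<forall>n. \<forall>i\<in>S n. \<forall>p\<in>pc n i \<inter> X. g s p \<notin> V n" if S: "S \<in> \<S>" for S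
  proof -
    define Q where "Q n = (\<lambda>i. (\<lambda>p s. g s p) ` (pc n i \<inter> X)) ` S n" for n
    have "\<exists>s\<in>{0..0 + T 0}. \<forall>n. \<forall>F\<in>Q n. \<forall>u\<in>F. u s \<notin> V n"
    proof (rule ex_common_escape[where N = slalom_width])
      show "T n > 0" for n by (rule Tpos)
      show "\<exists>r. escapable (slalom_width n) (T n) (V n) (T (Suc n)) r \<and>
         (\<forall>F\<in>Q n. \<forall>u\<in>F. \<forall>v\<in>F. \<forall>s\<in>{0..0 + T 0}. \<bar>u s - v s\<bar> \<le> r)" for n
        using V[of n] pc(2)[of _ n] unfolding Good_def Q_def T0 by (intro exI[of _ "\<rho> n"]) auto
      show "finite (Q n)" for n unfolding Q_def using bspec[OF \<S>(2) S] by simp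
      show "card (Q n) \<le> slalom_width n" for n
        unfolding Q_def using bspec[OF \<S>(2) S] by (meson card_image_le le_trans)
      show "quasi_shift_on {0..0 + T 0} u" if "F \<in> Q n" "u \<in> F" for n F u
        using that qs unfolding Q_def T0 by auto
    qed
    then show ?thesis unfolding Q_def T0 by auto
  qed
  then obtain \<alpha> where \<alpha>: "\<And>S. S \<in> \<S> \<Longrightarrow> \<alpha> S \<in> {0..\<sigma>}"
    "\<And>S n i p. S \<in> \<S> \<Longrightarrow> i \<in> S n \<Longrightarrow> p \<in> pc n i \<inter> X \<Longrightarrow> g (\<alpha> S) p \<notin> V n" by metis
  show ?thesis
  proof (intro exI conjI ballI)
    show "compact C" "negligible C" by fact+
    show "\<alpha> ` \<S> \<subseteq> {0..\<sigma>}" using \<alpha>(1) by auto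
    show "|\<alpha> ` \<S>| \<le>o cof_null" by (rule image_le_cof_null[OF \<S>(1)])
    fix p assume p: "p \<in> X"
    have "\<forall>n. \<exists>i. p \<in> pc n i" using pc(1) p by blast
    then obtain f where f: "\<And>n. p \<in> pc n (f n)" by metis
    obtain S where S: "S \<in> \<S>" "\<And>n. f n \<in> S n" using \<S>(3) by blast
    have "g (\<alpha> S) p \<notin> V n" for n using \<alpha>(2)[OF S(1) S(2)] f p by blast
    moreover have "\<bar>g (\<alpha> S) p\<bar> \<le> real R" using bd[OF p \<alpha>(1)[OF S(1)]] .
    ultimately have "g (\<alpha> S) p \<in> C" unfolding C_def by auto
    then show "\<exists>s\<in>\<alpha> ` \<S>. g s p \<in> C" using S(1) by blast
  qed
qed

section \<open>Translates in topological groups\<close>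

lemma mem_translate_iff: "x \<in> (+) a ` S \<longleftrightarrow> - a + x \<in> S" for a :: "'a::group_add"
proof
  assume "- a + x \<in> S"
  then show "x \<in> (+) a ` S" by (intro image_eqI[of _ _ "- a + x"]) (simp_all add: add.assoc[symmetric])
qed (auto simp: add.assoc[symmetric])

lemma translate_eq_vimage: "(+) a ` S = (\<lambda>x. - a + x) -` S" for a :: "'a::group_add"
  by (auto simp: mem_translate_iff)

lemma open_translate: "open S \<Longrightarrow> open ((+) a ` S)" for a :: "'a::topological_group_add"
  unfolding translate_eq_vimage by (intro open_vimage continuous_intros)

lemma compact_translate: "compact S \<Longrightarrow> compact ((+) a ` S)" for a :: "'a::topological_group_add"
  by (intro compact_continuous_image continuous_intros)

text \<open>
  Finitely many translates of \<open>N\<close>, with translating set \<open>F\<close>, cover \<open>K + K\<close>. If \<open>D\<close> is the countable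
  set of all finite sums from \<open>F\<close>, then \<open>D + K\<close> is stable under adding elements of \<open>K\<close> on the right,
  therefore open and closed.
\<close>

lemma identity_component_countable_translates:
  fixes K N :: "'a::{topological_group_add,t2_space} set"
  assumes K: "compact K" and N: "open N" "0 \<in> N" "N \<subseteq> K"
  obtains D where "countable D" "identity_component \<subseteq> (\<Union>d\<in>D. (+) d ` K)"
proof -
  define K2 where "K2 = (\<lambda>(x, y). x + y) ` (K \<times> K)"
  have "compact K2"
    unfolding K2_def split_def by (intro compact_continuous_image compact_Times K continuous_intros)
  moreover have "K2 \<subseteq> (\<Union>d\<in>K2. (+) d ` N)" using N(2) by (force simp: mem_translate_iff)
  ultimately obtain F where F: "F \<subseteq> K2" "finite F" "K2 \<subseteq> (\<Union>d\<in>F. (+) d ` N)"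
    using compactE_image[of K2 K2 "\<lambda>d. (+) d ` N"] open_translate[OF N(1)] by metis
  define D where "D = sum_list ` lists F"
  have cD: "countable D" unfolding D_def using F(2) by (simp add: countable_finite)
  have D0: "0 \<in> D" unfolding D_def by (intro image_eqI[of _ _ "[]"]) auto
  have Dadd: "d + f \<in> D" if "d \<in> D" "f \<in> F" for d f
  proof -
    from that(1) obtain xs where "xs \<in> lists F" "d = sum_list xs" unfolding D_def by blast
    then show ?thesis unfolding D_def using that(2) by (intro image_eqI[of _ _ "xs @ [f]"]) auto
  qed
  define L where "L = (\<Union>d\<in>D. (+) d ` K)"
  have LK: "x + k \<in> (\<Union>d\<in>D. (+) d ` N)" if "x \<in> L" "k \<in> K" for x k
  proof -
    from that(1) obtain d k1 where x: "d \<in> D" "k1 \<in> K" "x = d + k1" unfolding L_def by blast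
    have "k1 + k \<in> K2" unfolding K2_def using x(2) that(2) by force
    then obtain f n where "f \<in> F" "n \<in> N" "k1 + k = f + n" using F(3) by blast
    then have "x + k = (d + f) + n" "d + f \<in> D" using x Dadd by (simp_all add: add.assoc)
    then show ?thesis using \<open>n \<in> N\<close> by blast
  qed
  have NL: "(\<Union>d\<in>D. (+) d ` N) \<subseteq> L" unfolding L_def using N(3) by blast
  have "L = (\<Union>d\<in>D. (+) d ` N)"
  proof
    show "L \<subseteq> (\<Union>d\<in>D. (+) d ` N)"
      using LK[of _ 0] N(2,3) by auto
  qed (rule NL)
  then have oL: "open L" using open_translate[OF N(1)] by auto
  have "\<exists>T. open T \<and> x \<in> T \<and> T \<subseteq> - L" if "x \<in> - L" for x
  proof (intro exI conjI)
    let ?T = "(\<lambda>y. - y + x) -` N"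
    show "open ?T" using N(1) by (intro open_vimage continuous_intros)
    show "x \<in> ?T" using N(2) by simp
    show "?T \<subseteq> - L"
    proof
      fix y assume y: "y \<in> ?T"
      show "y \<in> - L"
      proof
        assume "y \<in> L"
        then have "y + (- y + x) \<in> L" using LK[of y "- y + x"] y N(3) NL by blast
        then show False using that by (simp add: add.assoc[symmetric])
      qed
    qed
  qed
  then have oC: "open (- L)" by (subst open_subopen) blast
  have conn: "connected (identity_component :: 'a set)"
    unfolding identity_component_def by (rule connected_connected_component)
  have "0 \<in> (identity_component :: 'a set)"
    unfolding identity_component_def by (simp add: connected_component_refl)
  moreover have "0 \<in> L" unfolding L_def using D0 N(2,3) by force
  ultimately have "- L \<inter> identity_component = {}"
    using connectedD[OF conn oL oC] by blast
  then have "identity_component \<subseteq> L" by blast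
  with cD that show thesis unfolding L_def by blast
qed

lemma nice_group_if_locally_covered:
  fixes K N C :: "'a::{topological_group_add,t2_space} set"
  assumes K: "compact K" and N: "open N" "0 \<in> N" "N \<subseteq> K"
    and C: "compact C" "haar_null C"
    and A: "|A| \<le>o cof_null" "K \<subseteq> (\<Union>a\<in>A. (+) a ` C)"
    and idx: "|left_cosets (identity_component :: 'a set)| \<le>o cof_null"
  shows "nice_group TYPE('a)"
proof -
  obtain D where D: "countable D" "identity_component \<subseteq> (\<Union>d\<in>D. (+) d ` K)"
    using identity_component_countable_translates[OF K N] .
  let ?L = "left_cosets (identity_component :: 'a set)"
  have "\<forall>X\<in>?L. \<exists>a. X = (+) a ` identity_component" unfolding left_cosets_def by blast
  from bchoice[OF this] obtain r where r: "\<forall>X\<in>?L. X = (+) (r X) ` identity_component" ..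
  define A' where "A' = (\<lambda>(X, d, a). r X + d + a) ` (?L \<times> D \<times> A)"
  have "|A'| \<le>o cof_null"
    unfolding A'_def by (intro image_le_cof_null Times_le_cof_null idx A countable_le_cof_null D)
  moreover have "(\<Union>a\<in>A'. (+) a ` C) = UNIV"
  proof -
    have "x \<in> (\<Union>a\<in>A'. (+) a ` C)" for x
    proof -
      have "0 \<in> (identity_component :: 'a set)"
        unfolding identity_component_def by (simp add: connected_component_refl)
      then have x: "x \<in> (+) x ` identity_component" by force
      define X where "X = (+) x ` identity_component"
      have X: "X \<in> ?L" unfolding X_def left_cosets_def by blast
      with x r obtain y where y: "y \<in> identity_component" "x = r X + y" unfolding X_def by blast
      then obtain d k where d: "d \<in> D" "k \<in> K" "y = d + k" using D(2) by blast
      then obtain a c where a: "a \<in> A" "c \<in> C" "k = a + c" using A(2) by blast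
      have "x = (r X + d + a) + c" using y d a by (simp add: add.assoc)
      moreover have "r X + d + a \<in> A'" unfolding A'_def using X d(1) a(1) by force
      ultimately show ?thesis using a(2) by blast
    qed
    then show ?thesis by blast
  qed
  moreover have "locally_compact_space (euclidean :: 'a topology)"
    unfolding locally_compact_space_def
  proof
    fix x :: 'a
    have "openin euclidean ((+) x ` N)" "compactin euclidean ((+) x ` K)"
      using open_translate[OF N(1)] compact_translate[OF K] by auto
    moreover have "x \<in> (+) x ` N" "(+) x ` N \<subseteq> (+) x ` K" using N by force+
    ultimately show "\<exists>U K. openin euclidean U \<and> compactin euclidean K \<and> x \<in> U \<and> U \<subseteq> K" by blast
  qed
  ultimately show ?thesis unfolding nice_group_def using C by blast
qed

section \<open>Haar null sets along a curve\<close>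

text \<open>
  The homeomorphism \<open>\<phi>\<close> transports the measure from \<open>W\<close> to a Euclidean space. There the Borel sets
  of the product with \<open>\<real>\<close> are generated by measurable rectangles, so that Fubini's theorem applies to a
  closed set of pairs; the group itself need not be second countable.
\<close>

lemma haar_null_if_null_along_curve:
  fixes C W :: "'a::{topological_group_add,t2_space} set" and \<gamma> :: "real \<Rightarrow> 'a"
    and \<phi> :: "'a \<Rightarrow> 'e::euclidean_space"
  assumes \<sigma>: "\<sigma> > 0" and C: "compact C" and W: "compact W"
    and hom: "homeomorphism W Q \<phi> \<psi>"
    and \<gamma>: "continuous_on {0..\<sigma>} \<gamma>"
    and sub: "\<And>s. s \<in> {0..\<sigma>} \<Longrightarrow> (+) (- \<gamma> s) ` C \<subseteq> W"
    and null: "\<And>x. x \<in> W \<Longrightarrow> negligible {s \<in> {0..\<sigma>}. \<gamma> s + x \<in> C}"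
  shows "haar_null C"
  unfolding haar_null_def
proof (intro allI impI)
  fix \<mu> :: "'a measure" assume \<mu>: "left_haar_measure \<mu>"
  note haar = \<mu>[unfolded left_haar_measure_def]
  have sets_\<mu>: "sets \<mu> = sets borel" by (rule haar[THEN conjunct1])
  have "\<forall>a. \<forall>B\<in>sets borel. emeasure \<mu> ((+) a ` B) = emeasure \<mu> B" using haar by (elim conjE)
  then have inv: "emeasure \<mu> ((+) a ` B) = emeasure \<mu> B" if "B \<in> sets borel" for a B
    using that by simp
  have "\<forall>K. compact K \<longrightarrow> emeasure \<mu> K < \<infinity>" using haar by (elim conjE)
  then have Wfin: "emeasure \<mu> W < \<infinity>" using W by simp
  have space_\<mu>: "space \<mu> = UNIV" using sets_eq_imp_space_eq[OF sets_\<mu>] by simp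
  have clW: "closed W" and clC: "closed C" using W C by (simp_all add: compact_imp_closed)
  have Ws: "W \<in> sets \<mu>" using clW sets_\<mu> by auto
  have Cs: "C \<in> sets borel" using clC by auto
  have im\<phi>: "\<phi> ` W = Q" and im\<psi>: "\<psi> ` Q = W"
    using homeomorphism_image1[OF hom] homeomorphism_image2[OF hom] by simp_all
  have c\<phi>: "continuous_on W \<phi>" and c\<psi>: "continuous_on Q \<psi>"
    using homeomorphism_cont1[OF hom] homeomorphism_cont2[OF hom] by simp_all
  have Q: "compact Q" using compact_continuous_image[OF c\<phi> W] unfolding im\<phi> .
  have \<phi>\<psi>: "\<psi> (\<phi> x) = x" "\<phi> x \<in> Q" if "x \<in> W" for x
    using homeomorphism_apply1[OF hom that] im\<phi> that by blast+
  have \<psi>W: "\<psi> q \<in> W" if "q \<in> Q" for q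
    using im\<psi> that by blast
  define \<mu>W where "\<mu>W = restrict_space \<mu> W"
  have sp: "space \<mu>W = W" unfolding \<mu>W_def by (simp add: space_restrict_space space_\<mu>)
  have meas: "\<phi> \<in> borel_measurable \<mu>W"
  proof -
    have "\<phi> \<in> borel_measurable (restrict_space borel W)"
      by (rule borel_measurable_continuous_on_restrict[OF c\<phi>])
    moreover have "sets \<mu>W = sets (restrict_space borel W)"
      unfolding \<mu>W_def by (rule sets_restrict_space_cong[OF sets_\<mu>])
    ultimately show ?thesis using measurable_cong_sets[OF _ refl] by metis
  qed
  define \<nu> where "\<nu> = distr \<mu>W borel \<phi>"
  have \<nu>: "emeasure \<nu> B = emeasure \<mu> (W \<inter> \<phi> -` B)" if "B \<in> sets borel" for B
  proof -
    have "emeasure \<nu> B = emeasure \<mu>W (\<phi> -` B \<inter> W)"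
      unfolding \<nu>_def using emeasure_distr[OF meas that] by (simp add: sp)
    also have "\<dots> = emeasure \<mu> (\<phi> -` B \<inter> W)"
      unfolding \<mu>W_def using Ws by (intro emeasure_restrict_space) (auto simp: space_\<mu>)
    finally show ?thesis by (simp add: Int_commute)
  qed
  interpret \<nu>: finite_measure \<nu>
  proof
    have "space \<nu> = UNIV" by (simp add: \<nu>_def)
    then have "emeasure \<nu> (space \<nu>) = emeasure \<mu> W" using \<nu>[of UNIV] by simp
    then show "emeasure \<nu> (space \<nu>) \<noteq> \<infinity>" using Wfin by auto
  qed
  interpret P: pair_sigma_finite lborel \<nu> ..
  define E where "E = ({0..\<sigma>} \<times> Q) \<inter> (\<lambda>(s, q). \<gamma> s + \<psi> q) -` C"
  have clE: "closed E"
    unfolding E_def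
  proof (rule continuous_closed_preimage)
    show "continuous_on ({0..\<sigma>} \<times> Q) (\<lambda>(s, q). \<gamma> s + \<psi> q)"
      unfolding split_def
      by (intro continuous_on_add continuous_on_compose2[OF \<gamma>] continuous_on_compose2[OF c\<psi>] continuous_intros) auto
    show "closed ({0..\<sigma>} \<times> Q)" using Q by (intro closed_Times compact_imp_closed) auto
  qed (rule clC)
  have E: "E \<in> sets (lborel \<Otimes>\<^sub>M \<nu>)"
  proof -
    have "sets (lborel \<Otimes>\<^sub>M \<nu>) = sets (borel \<Otimes>\<^sub>M (borel :: 'e measure))"
      by (rule sets_pair_measure_cong) (simp_all add: \<nu>_def)
    then show ?thesis unfolding borel_prod using clE by (metis borel_closed)
  qed
  have "emeasure \<nu> (Pair s -` E) = emeasure \<mu> C * indicator {0..\<sigma>} s" for s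
  proof (cases "s \<in> {0..\<sigma>}")
    case True
    have Es: "Pair s -` E \<in> sets borel"
      using sets_Pair1[OF E, of s] by (simp add: \<nu>_def)
    have "W \<inter> \<phi> -` Pair s -` E = (+) (- \<gamma> s) ` C"
    proof
      show "W \<inter> \<phi> -` Pair s -` E \<subseteq> (+) (- \<gamma> s) ` C"
        by (auto simp: mem_translate_iff E_def \<phi>\<psi>)
      show "(+) (- \<gamma> s) ` C \<subseteq> W \<inter> \<phi> -` Pair s -` E"
        using sub[OF True] True by (auto simp: E_def \<phi>\<psi> subset_iff add.assoc[symmetric])
    qed
    then show ?thesis using \<nu>[OF Es] inv[OF Cs] True by simp
  next
    case False
    then have "Pair s -` E = {}" unfolding E_def by auto
    with False show ?thesis by simp
  qed
  then have "emeasure (lborel \<Otimes>\<^sub>M \<nu>) E = (\<integral>\<^sup>+s. emeasure \<mu> C * indicator {0..\<sigma>} s \<partial>lborel)"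
    using \<nu>.emeasure_pair_measure_alt[OF E] by simp
  also have "\<dots> = emeasure \<mu> C * ennreal \<sigma>" using \<sigma> by (subst nn_integral_cmult_indicator) auto
  finally have 1: "emeasure (lborel \<Otimes>\<^sub>M \<nu>) E = emeasure \<mu> C * ennreal \<sigma>" .
  have "emeasure lborel ((\<lambda>s. (s, q)) -` E) = 0" for q
  proof (cases "q \<in> Q")
    case True
    have "(\<lambda>s. (s, q)) -` E = {s \<in> {0..\<sigma>}. \<gamma> s + \<psi> q \<in> C}" using True unfolding E_def by auto
    then have "negligible ((\<lambda>s. (s, q)) -` E)" using null[OF \<psi>W[OF True]] by simp
    moreover have "(\<lambda>s. (s, q)) -` E \<in> sets borel"
      using sets_Pair2[OF E, of q] by simp
    ultimately have "(\<lambda>s. (s, q)) -` E \<in> null_sets lborel"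
      unfolding negligible_iff_null_sets by (subst (asm) null_sets_completion_iff) simp_all
    then show ?thesis by (rule null_setsD1)
  next
    case False
    then have "(\<lambda>s. (s, q)) -` E = {}" unfolding E_def by auto
    then show ?thesis by simp
  qed
  then have "emeasure (lborel \<Otimes>\<^sub>M \<nu>) E = 0"
    using P.emeasure_pair_measure_alt2[OF E] by simp
  with 1 \<sigma> have "emeasure \<mu> C = 0" by simp
  then show "C \<in> null_sets \<mu>" using Cs sets_\<mu> by auto
qed

text \<open>A quasi-shift has a Lipschitz inverse, and Lipschitz maps preserve null sets.\<close>

lemma negligible_quasi_shift_preimage:
  assumes u: "quasi_shift_on I u" and N: "negligible N"
  shows "negligible {s \<in> I. u s \<in> N}"
proof -
  define S where "S = {s \<in> I. u s \<in> N}"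
  have lip_le: "\<bar>t - s\<bar> \<le> 2 * \<bar>u t - u s\<bar>" if "s \<in> I" "t \<in> I" "s \<le> t" for s t
  proof -
    have "(t - s) / 2 \<le> u t - u s" using u that unfolding quasi_shift_on_def by blast
    then have "\<bar>t - s\<bar> / 2 \<le> \<bar>u t - u s\<bar>" using that(3) by linarith
    then show ?thesis by (simp only: pos_divide_le_eq zero_less_numeral mult.commute)
  qed
  have lip: "\<bar>t - s\<bar> \<le> 2 * \<bar>u t - u s\<bar>" if "s \<in> I" "t \<in> I" for s t
  proof (cases "s \<le> t")
    case True
    with that show ?thesis by (intro lip_le)
  next
    case False
    with that have "\<bar>s - t\<bar> \<le> 2 * \<bar>u s - u t\<bar>" by (intro lip_le) simp_all
    then show ?thesis by (simp only: abs_minus_commute)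
  qed
  have inj: "inj_on u S"
  proof (rule inj_onI)
    fix s t assume st: "s \<in> S" "t \<in> S" "u s = u t"
    then have "\<bar>t - s\<bar> \<le> 2 * \<bar>u t - u s\<bar>" by (intro lip) (simp_all add: S_def)
    with st(3) show "s = t" by simp
  qed
  have "negligible (inv_into S u ` (u ` S))"
  proof (rule negligible_locally_Lipschitz_image)
    show "negligible (u ` S)" by (rule negligible_subset[OF N]) (auto simp: S_def)
    fix x assume "x \<in> u ` S"
    then obtain s where s: "s \<in> S" "x = u s" by blast
    have "norm (inv_into S u y - inv_into S u x) \<le> 2 * norm (y - x)" if "y \<in> u ` S" for y
    proof -
      from that obtain t where t: "t \<in> S" "y = u t" by blast
      have "inv_into S u y = t" "inv_into S u x = s"
        using inv_into_f_f[OF inj] s t by simp_all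
      then show ?thesis using lip[of s t] s t unfolding S_def by simp
    qed
    then show "\<exists>T B. open T \<and> x \<in> T \<and> (\<forall>y\<in>u ` S \<inter> T. norm (inv_into S u y - inv_into S u x) \<le> B * norm (y - x))"
      by (intro exI[of _ UNIV] exI[of _ 2] conjI ballI open_UNIV UNIV_I) blast
  qed simp
  then show ?thesis using inv_into_image_cancel[OF inj subset_refl] unfolding S_def by simp
qed

section \<open>Groups with a continuously differentiable chart\<close>

lemma open_prod_contains_cballs:
  fixes e :: "'e::metric_space"
  assumes "open T" "(e, e) \<in> T"
  obtains r where "r > 0" "cball e r \<times> cball e r \<subseteq> T"
proof -
  obtain A B where AB: "open A" "open B" "(e, e) \<in> A \<times> B" "A \<times> B \<subseteq> T"
    using open_prod_elim[OF assms] .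
  then have "open (A \<inter> B)" "e \<in> A \<inter> B" by auto
  then obtain r where "r > 0" "cball e r \<subseteq> A \<inter> B" by (metis open_contains_cball)
  then have "cball e r \<times> cball e r \<subseteq> T" using AB(4) by blast
  with \<open>r > 0\<close> that show thesis by blast
qed

lemma quasi_shift_on_if_derivative:
  fixes u h :: "real \<Rightarrow> real"
  assumes der: "\<And>s. s \<in> {a..b} \<Longrightarrow> (u has_real_derivative h s) (at s)"
    and h: "\<And>s. s \<in> {a..b} \<Longrightarrow> 1 / 2 \<le> h s \<and> h s \<le> 2"
  shows "quasi_shift_on {a..b} u"
  unfolding quasi_shift_on_def
proof (intro ballI impI)
  fix s t assume st: "s \<in> {a..b}" "t \<in> {a..b}" "s \<le> t"
  show "(t - s) / 2 \<le> u t - u s \<and> u t - u s \<le> 2 * (t - s)"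
  proof (cases "s = t")
    case False
    with st have "s < t" by simp
    moreover have "DERIV u x :> h x" if "s \<le> x" "x \<le> t" for x using der that st by auto
    ultimately obtain z where z: "s < z" "z < t" "u t - u s = (t - s) * h z"
      using MVT2[of s t u h] by blast
    have hz: "1 / 2 \<le> h z" "h z \<le> 2" using h[of z] z st by auto
    have ts: "0 \<le> t - s" using \<open>s < t\<close> by simp
    have "(t - s) * (1 / 2) \<le> (t - s) * h z" by (rule mult_left_mono[OF hz(1) ts])
    moreover have "(t - s) * h z \<le> (t - s) * 2" by (rule mult_left_mono[OF hz(2) ts])
    ultimately show ?thesis using z(3) by simp
  qed simp
qed

lemma uniformly_small_countable_cover:
  fixes g :: "real \<Rightarrow> 'e::metric_space \<Rightarrow> real"
  assumes cont: "continuous_on ({0..\<sigma>} \<times> X) (\<lambda>(s, q). g s q)" and X: "compact X" and \<rho>: "\<rho> > 0"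
  shows "\<exists>\<P>. countable \<P> \<and> X \<subseteq> \<Union>\<P> \<and>
      (\<forall>P\<in>\<P>. \<forall>p\<in>P \<inter> X. \<forall>q\<in>P \<inter> X. \<forall>s\<in>{0..\<sigma>}. \<bar>g s p - g s q\<bar> \<le> \<rho>)"
proof -
  have "uniformly_continuous_on ({0..\<sigma>} \<times> X) (\<lambda>(s, q). g s q)"
    by (intro compact_uniformly_continuous[OF cont] compact_Times X) simp
  from this[unfolded uniformly_continuous_on_def, rule_format, OF \<rho>]
  obtain d where d: "d > 0" "\<And>z w. z \<in> {0..\<sigma>} \<times> X \<Longrightarrow> w \<in> {0..\<sigma>} \<times> X \<Longrightarrow> dist w z < d \<Longrightarrow>
    dist ((\<lambda>(s, q). g s q) w) ((\<lambda>(s, q). g s q) z) < \<rho>" by blast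
  have "\<forall>e>0. \<exists>k. finite k \<and> X \<subseteq> (\<Union>x\<in>k. ball x e)"
    using X unfolding compact_eq_totally_bounded by (rule conjunct2)
  then obtain k where k: "finite k" "X \<subseteq> (\<Union>x\<in>k. ball x (d / 2))" using d(1) half_gt_zero by blast
  show ?thesis
  proof (intro exI[of _ "(\<lambda>x. ball x (d / 2)) ` k"] conjI ballI)
    show "countable ((\<lambda>x. ball x (d / 2)) ` k)" using k(1) by (simp add: countable_finite)
    show "X \<subseteq> \<Union>((\<lambda>x. ball x (d / 2)) ` k)" by (rule k(2))
    fix P p q s assume P: "P \<in> (\<lambda>x. ball x (d / 2)) ` k" "p \<in> P \<inter> X" "q \<in> P \<inter> X" "s \<in> {0..\<sigma>}"
    then obtain x where "dist x p < d / 2" "dist x q < d / 2" by auto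
    then have "dist p q < d" by (rule dist_triangle_half_r)
    then have "dist (s, p) (s, q) < d" by (simp add: dist_Pair_Pair)
    moreover have "(s, p) \<in> {0..\<sigma>} \<times> X" "(s, q) \<in> {0..\<sigma>} \<times> X" using P by auto
    ultimately have "dist (g s p) (g s q) < \<rho>" using d(2)[of "(s, q)" "(s, p)"] by simp
    then show "\<bar>g s p - g s q\<bar> \<le> \<rho>" by (simp add: dist_real_def)
  qed
qed

text \<open>
  A single chart at the identity in which the multiplication is continuously differentiable suffices; no
  differentiability of the inversion is needed, its continuity being part of the topological group.
\<close>

theorem nice_group_if_C1_chart:
  fixes U :: "'a::{topological_group_add,t2_space} set" and \<phi> :: "'a \<Rightarrow> 'e::euclidean_space"
  defines "M \<equiv> \<lambda>(p, q). \<phi> (inv_into U \<phi> p + inv_into U \<phi> q)"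
    and "S \<equiv> {(p, q). p \<in> \<phi> ` U \<and> q \<in> \<phi> ` U \<and> inv_into U \<phi> p + inv_into U \<phi> q \<in> U}"
  assumes chart: "is_chart (U, \<phi>)" and U0: "0 \<in> U" and C1: "Ck_on 1 M S"
    and idx: "|left_cosets (identity_component :: 'a set)| \<le>o cof_null"
  shows "nice_group TYPE('a)"
proof -
  define \<psi> where "\<psi> = inv_into U \<phi>"
  define e where "e = \<phi> 0"
  have oU: "open U" and oV: "open (\<phi> ` U)" and hom: "homeomorphism U (\<phi> ` U) \<phi> \<psi>"
    using chart unfolding is_chart_def \<psi>_def by auto
  have M: "M (p, q) = \<phi> (\<psi> p + \<psi> q)" for p q unfolding M_def \<psi>_def by simp
  have S: "(p, q) \<in> S \<longleftrightarrow> p \<in> \<phi> ` U \<and> q \<in> \<phi> ` U \<and> \<psi> p + \<psi> q \<in> U" for p q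
    unfolding S_def \<psi>_def by simp
  have \<psi>\<phi>: "\<psi> (\<phi> x) = x" if "x \<in> U" for x using homeomorphism_apply1[OF hom that] .
  have \<phi>\<psi>: "\<phi> (\<psi> y) = y" "\<psi> y \<in> U" if "y \<in> \<phi> ` U" for y
    using homeomorphism_apply2[OF hom that] homeomorphism_image2[OF hom] that by blast+
  have c\<phi>: "continuous_on U \<phi>" and c\<psi>: "continuous_on (\<phi> ` U) \<psi>"
    using homeomorphism_cont1[OF hom] homeomorphism_cont2[OF hom] by simp_all
  have eV: "e \<in> \<phi> ` U" and \<psi>e: "\<psi> e = 0" unfolding e_def using U0 \<psi>\<phi> by auto
  have ee: "(e, e) \<in> S" unfolding S using eV \<psi>e U0 by simp
  have c2: "continuous_on (\<phi> ` U \<times> \<phi> ` U) (\<lambda>z. \<psi> (fst z) + \<psi> (snd z))"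
    "continuous_on (\<phi> ` U \<times> \<phi> ` U) (\<lambda>z. - \<psi> (fst z) + \<psi> (snd z))"
    by (intro continuous_on_add continuous_on_minus continuous_on_compose2[OF c\<psi>]
        continuous_on_fst continuous_on_snd continuous_on_id; auto)+
  have oS: "open S"
  proof -
    have "S = (\<phi> ` U \<times> \<phi> ` U) \<inter> (\<lambda>z. \<psi> (fst z) + \<psi> (snd z)) -` U"
      by (auto simp: S)
    then show ?thesis using continuous_open_preimage[OF c2(1) open_Times[OF oV oV] oU] by simp
  qed
  have dM: "M differentiable (at z)" if "z \<in> S" for z using C1 that by simp
  have cD: "continuous_on S (\<lambda>z. frechet_derivative M (at z) v)" for v
    using C1 unfolding One_nat_def Ck_on.simps by blast
  have cM: "continuous_on S M"
    using dM by (meson continuous_at_imp_continuous_on differentiable_imp_continuous_within)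
  obtain b :: 'e where b: "b \<in> Basis" using nonempty_Basis by blast
  have nb: "norm b = 1" using b by simp
  \<comment> \<open>\<open>h\<close> is the \<open>b\<close>-component of the derivative of \<open>M\<close> when its first argument moves in direction \<open>b\<close>.\<close>
  define h where "h z = frechet_derivative M (at z) (b, 0) \<bullet> b" for z
  have ch: "continuous_on S h" unfolding h_def by (intro continuous_intros cD)
  have der: "((\<lambda>s. M (e + s *\<^sub>R b, q) \<bullet> b) has_real_derivative h (e + s *\<^sub>R b, q)) (at s)"
    if "(e + s *\<^sub>R b, q) \<in> S" for s q
  proof -
    let ?D = "frechet_derivative M (at (e + s *\<^sub>R b, q))"
    have D: "(M has_derivative ?D) (at (e + s *\<^sub>R b, q))"
      using dM[OF that] frechet_derivative_works by blast
    have "((\<lambda>s. (e + s *\<^sub>R b, q)) has_derivative (\<lambda>t. (t *\<^sub>R b, 0))) (at s)"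
      by (auto intro!: derivative_eq_intros)
    from diff_chain_at[OF this D]
    have "((\<lambda>s. M (e + s *\<^sub>R b, q)) has_derivative (\<lambda>t. ?D (t *\<^sub>R b, 0))) (at s)"
      by (simp add: o_def)
    then have "((\<lambda>s. M (e + s *\<^sub>R b, q) \<bullet> b) has_derivative (\<lambda>t. ?D (t *\<^sub>R b, 0) \<bullet> b)) (at s)"
      by (rule has_derivative_inner_left)
    moreover have "?D (t *\<^sub>R b, 0) = t *\<^sub>R ?D (b, 0)" for t
      using linear_cmul[OF has_derivative_linear[OF D], of t "(b, 0)"] by simp
    ultimately show ?thesis
      unfolding has_field_derivative_def h_def by (simp add: mult_commute_abs)
  qed
  have h1: "h (e, e) = 1"
  proof -
    obtain r where r: "r > 0" "cball e r \<subseteq> \<phi> ` U" using oV eV by (metis open_contains_cball)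
    have d1: "((\<lambda>s. M (e + s *\<^sub>R b, e) \<bullet> b) has_real_derivative h (e, e)) (at 0)"
      using der[of 0 e] ee by simp
    have d2: "((\<lambda>s. (e + s *\<^sub>R b) \<bullet> b) has_real_derivative 1) (at 0)"
      using b by (auto intro!: derivative_eq_intros simp: inner_add_left)
    have ev: "\<forall>\<^sub>F s in nhds 0. M (e + s *\<^sub>R b, e) \<bullet> b = (e + s *\<^sub>R b) \<bullet> b"
      unfolding eventually_nhds_metric
    proof (intro exI[of _ r] conjI allI impI r(1))
      fix s :: real assume "dist s 0 < r"
      then have "e + s *\<^sub>R b \<in> cball e r" using nb by (simp add: dist_norm)
      then have "e + s *\<^sub>R b \<in> \<phi> ` U" using r(2) by blast
      then show "M (e + s *\<^sub>R b, e) \<bullet> b = (e + s *\<^sub>R b) \<bullet> b" by (simp add: M \<psi>e \<phi>\<psi>)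
    qed
    show ?thesis by (rule DERIV_unique[OF d1 iffD2[OF DERIV_cong_ev[OF refl ev refl] d2]])
  qed
  \<comment> \<open>Radii \<open>r \<ge> r2 \<ge> \<sigma>\<close>: the derivative is controlled up to \<open>r\<close>; the translates of points at distance at
    most \<open>r2\<close> from \<open>e\<close> by the negatives \<open>- \<gamma> s\<close> stay within \<open>r\<close>; the translates of points at distance at most
    \<open>\<sigma>\<close> by \<open>\<gamma> s\<close> stay within \<open>r2\<close>.\<close>
  have "open (S \<inter> h -` {1/2<..<2})" by (rule continuous_open_preimage[OF ch oS]) simp
  moreover have "(e, e) \<in> S \<inter> h -` {1/2<..<2}" using ee h1 by simp
  ultimately obtain r where r: "r > 0" "cball e r \<times> cball e r \<subseteq> S \<inter> h -` {1/2<..<2}"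
    by (rule open_prod_contains_cballs)
  have rV: "cball e r \<subseteq> \<phi> ` U"
  proof
    fix y assume "y \<in> cball e r"
    then have "(y, y) \<in> S" using r(2) by blast
    then show "y \<in> \<phi> ` U" by (simp add: S)
  qed
  have o\<psi>: "open (\<psi> ` ball e t)" if "t \<le> r" for t
  proof -
    have sub: "ball e t \<subseteq> \<phi> ` U" using rV that ball_subset_cball[of e t] subset_cball[OF that, of e] by blast
    have "\<psi> ` ball e t = U \<inter> \<phi> -` ball e t"
    proof
      show "\<psi> ` ball e t \<subseteq> U \<inter> \<phi> -` ball e t" using sub \<phi>\<psi> by force
      show "U \<inter> \<phi> -` ball e t \<subseteq> \<psi> ` ball e t" using \<psi>\<phi> by force
    qed
    then show ?thesis using continuous_open_preimage[OF c\<phi> oU open_ball] by simp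
  qed
  have "open ((\<phi> ` U \<times> \<phi> ` U) \<inter> (\<lambda>z. - \<psi> (fst z) + \<psi> (snd z)) -` (\<psi> ` ball e r))"
    by (rule continuous_open_preimage[OF c2(2) open_Times[OF oV oV] o\<psi>]) simp
  moreover have "(e, e) \<in> (\<phi> ` U \<times> \<phi> ` U) \<inter> (\<lambda>z. - \<psi> (fst z) + \<psi> (snd z)) -` (\<psi> ` ball e r)"
    using eV r(1) \<psi>e by (auto intro!: image_eqI[of _ _ e])
  ultimately obtain r2' where r2': "r2' > 0" "cball e r2' \<times> cball e r2' \<subseteq>
     (\<phi> ` U \<times> \<phi> ` U) \<inter> (\<lambda>z. - \<psi> (fst z) + \<psi> (snd z)) -` (\<psi> ` ball e r)"
    by (rule open_prod_contains_cballs)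
  define r2 where "r2 = min r r2'"
  have r2: "r2 > 0" "r2 \<le> r" "r2 \<le> r2'" unfolding r2_def using r(1) r2'(1) by auto
  have "open (S \<inter> M -` ball e r2)" by (rule continuous_open_preimage[OF cM oS open_ball])
  moreover have "M (e, e) = e" unfolding M \<psi>e by (simp add: e_def)
  with ee r2(1) have "(e, e) \<in> S \<inter> M -` ball e r2" by simp
  ultimately obtain \<sigma>' where \<sigma>': "\<sigma>' > 0" "cball e \<sigma>' \<times> cball e \<sigma>' \<subseteq> S \<inter> M -` ball e r2"
    by (rule open_prod_contains_cballs)
  define \<sigma> where "\<sigma> = min \<sigma>' r2"
  have \<sigma>: "\<sigma> > 0" "\<sigma> \<le> \<sigma>'" "\<sigma> \<le> r2" unfolding \<sigma>_def using \<sigma>'(1) r2(1) by auto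
  define X where "X = cball e \<sigma>"
  define g where "g s q = M (e + s *\<^sub>R b, q) \<bullet> b" for s q
  define \<gamma> where "\<gamma> s = \<psi> (e + s *\<^sub>R b)" for s
  have eb: "e + s *\<^sub>R b \<in> cball e \<sigma>" if "s \<in> {0..\<sigma>}" for s using that nb by (simp add: dist_norm)
  have balls: "cball e \<sigma> \<subseteq> cball e \<sigma>'" "cball e \<sigma> \<subseteq> cball e r2" "cball e r2 \<subseteq> cball e r" "cball e r2 \<subseteq> cball e r2'"
    using \<sigma> r2 by (auto intro!: subset_cball)
  have qs: "quasi_shift_on {0..\<sigma>} (\<lambda>s. g s q)" if "q \<in> cball e r" for q
    unfolding g_def
  proof (rule quasi_shift_on_if_derivative)
    fix s assume s: "s \<in> {0..\<sigma>}"
    have in_S: "(e + s *\<^sub>R b, q) \<in> S \<inter> h -` {1/2<..<2}" using r(2) eb[OF s] balls that by blast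
    then show "((\<lambda>s. M (e + s *\<^sub>R b, q) \<bullet> b) has_real_derivative h (e + s *\<^sub>R b, q)) (at s)"
      by (intro der) simp
    show "1 / 2 \<le> h (e + s *\<^sub>R b, q) \<and> h (e + s *\<^sub>R b, q) \<le> 2" using in_S by auto
  qed
  have XS: "(e + s *\<^sub>R b, q) \<in> S" "M (e + s *\<^sub>R b, q) \<in> ball e r2" if "s \<in> {0..\<sigma>}" "q \<in> X" for s q
    using \<sigma>'(2) eb[OF that(1)] that(2) balls unfolding X_def by blast+
  have cg: "continuous_on ({0..\<sigma>} \<times> X) (\<lambda>(s, q). g s q)"
    unfolding g_def split_def
  proof (intro continuous_on_inner continuous_on_const continuous_on_compose2[OF cM])
    show "continuous_on ({0..\<sigma>} \<times> X) (\<lambda>z. (e + fst z *\<^sub>R b, snd z))" by (intro continuous_intros)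
    show "(\<lambda>z. (e + fst z *\<^sub>R b, snd z)) ` ({0..\<sigma>} \<times> X) \<subseteq> S" using XS(1) by auto
  qed
  obtain R :: nat where R: "norm e + r2 \<le> real R" using real_arch_simple by blast
  have bd: "\<bar>g s q\<bar> \<le> real R" if "q \<in> X" "s \<in> {0..\<sigma>}" for s q
  proof -
    have "\<bar>g s q\<bar> \<le> norm (M (e + s *\<^sub>R b, q))" unfolding g_def using Basis_le_norm[OF b] .
    also have "\<dots> \<le> norm e + r2"
      using XS(2)[OF that(2,1)] norm_triangle_ineq2[of "M (e + s *\<^sub>R b, q)" e]
      by (simp add: dist_norm norm_minus_commute)
    finally show ?thesis using R by linarith
  qed
  have "\<exists>C A. compact C \<and> negligible C \<and> A \<subseteq> {0..\<sigma>} \<and> |A| \<le>o cof_null \<and> (\<forall>q\<in>X. \<exists>s\<in>A. g s q \<in> C)"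
  proof (rule ex_compact_null_hit_by_shifts[OF \<sigma>(1)])
    show "quasi_shift_on {0..\<sigma>} (\<lambda>s. g s q)" if "q \<in> X" for q
      using qs that balls unfolding X_def by blast
    show "\<exists>\<P>. countable \<P> \<and> X \<subseteq> \<Union>\<P> \<and>
      (\<forall>P\<in>\<P>. \<forall>p\<in>P \<inter> X. \<forall>q\<in>P \<inter> X. \<forall>s\<in>{0..\<sigma>}. \<bar>g s p - g s q\<bar> \<le> \<rho>)" if "\<rho> > 0" for \<rho>
      by (rule uniformly_small_countable_cover[OF cg _ that]) (simp add: X_def)
    show "\<bar>g s q\<bar> \<le> real R" if "q \<in> X" "s \<in> {0..\<sigma>}" for q s by (rule bd[OF that])
  qed
  then obtain C1 A where CA: "compact C1" "negligible C1" "A \<subseteq> {0..\<sigma>}" "|A| \<le>o cof_null"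
    "\<forall>q\<in>X. \<exists>s\<in>A. g s q \<in> C1" by (elim exE conjE)
  define C where "C = \<psi> ` (cball e r2 \<inter> (\<lambda>y. y \<bullet> b) -` C1)"
  have cC: "compact C"
    unfolding C_def
  proof (rule compact_continuous_image)
    show "continuous_on (cball e r2 \<inter> (\<lambda>y. y \<bullet> b) -` C1) \<psi>"
      by (rule continuous_on_subset[OF c\<psi>]) (use rV balls in blast)
    have "closed ((\<lambda>y. y \<bullet> b) -` C1)"
      by (intro closed_vimage compact_imp_closed CA(1) continuous_intros)
    then show "compact (cball e r2 \<inter> (\<lambda>y. y \<bullet> b) -` C1)" by (intro compact_Int_closed) auto
  qed
  have C_iff: "\<psi> y \<in> C \<Longrightarrow> y \<in> \<phi> ` U \<Longrightarrow> y \<bullet> b \<in> C1" for y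
  proof -
    assume y: "\<psi> y \<in> C" "y \<in> \<phi> ` U"
    then obtain y' where y': "y' \<in> cball e r2" "y' \<bullet> b \<in> C1" "\<psi> y = \<psi> y'" unfolding C_def by blast
    then have "y' \<in> \<phi> ` U" using rV balls by blast
    then have "y = y'" using y'(3) y(2) \<phi>\<psi>(1) by metis
    with y' show ?thesis by simp
  qed
  have hn: "haar_null C"
  proof (rule haar_null_if_null_along_curve[OF \<sigma>(1) cC])
    show "compact (\<psi> ` cball e r)"
      by (intro compact_continuous_image continuous_on_subset[OF c\<psi> rV]) simp
    show "homeomorphism (\<psi> ` cball e r) (cball e r) \<phi> \<psi>"
    proof (rule homeomorphism_of_subsets[OF hom])
      show "\<psi> ` cball e r \<subseteq> U" using rV \<phi>\<psi>(2) by blast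
      show "cball e r \<subseteq> \<phi> ` U" by (rule rV)
      show "\<phi> ` \<psi> ` cball e r = cball e r" using rV \<phi>\<psi>(1) by (force simp: image_image)
    qed
    show "continuous_on {0..\<sigma>} \<gamma>"
      unfolding \<gamma>_def
    proof (rule continuous_on_compose2[OF c\<psi>])
      show "continuous_on {0..\<sigma>} (\<lambda>s. e + s *\<^sub>R b)" by (intro continuous_intros)
      show "(\<lambda>s. e + s *\<^sub>R b) ` {0..\<sigma>} \<subseteq> \<phi> ` U" using eb balls rV by blast
    qed
    show "(+) (- \<gamma> s) ` C \<subseteq> \<psi> ` cball e r" if s: "s \<in> {0..\<sigma>}" for s
    proof
      fix x assume "x \<in> (+) (- \<gamma> s) ` C"
      then obtain y where y: "y \<in> cball e r2" "x = - \<gamma> s + \<psi> y" unfolding C_def by blast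
      have "(e + s *\<^sub>R b, y) \<in> cball e r2' \<times> cball e r2'" using eb[OF s] y(1) balls by blast
      then have "x \<in> \<psi> ` ball e r" using r2'(2) unfolding y(2) \<gamma>_def by force
      then show "x \<in> \<psi> ` cball e r" using ball_subset_cball by blast
    qed
    fix x assume "x \<in> \<psi> ` cball e r"
    then obtain q where q: "q \<in> cball e r" "x = \<psi> q" by blast
    have "{s \<in> {0..\<sigma>}. \<gamma> s + x \<in> C} \<subseteq> {s \<in> {0..\<sigma>}. g s q \<in> C1}"
    proof clarify
      fix s assume s: "s \<in> {0..\<sigma>}" "\<gamma> s + x \<in> C"
      have "(e + s *\<^sub>R b, q) \<in> S" using r(2) eb[OF s(1)] balls q(1) by blast
      then have "\<psi> (e + s *\<^sub>R b) + \<psi> q \<in> U" by (simp add: S)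
      then have "\<psi> (M (e + s *\<^sub>R b, q)) = \<gamma> s + x" "M (e + s *\<^sub>R b, q) \<in> \<phi> ` U"
        by (simp_all add: M \<gamma>_def q(2) \<psi>\<phi>)
      then show "g s q \<in> C1" unfolding g_def using C_iff s(2) by metis
    qed
    then show "negligible {s \<in> {0..\<sigma>}. \<gamma> s + x \<in> C}"
      using negligible_subset negligible_quasi_shift_preimage[OF qs[OF q(1)] CA(2)] by blast
  qed
  show ?thesis
  proof (rule nice_group_if_locally_covered[where K = "\<psi> ` X" and N = "\<psi> ` ball e \<sigma>" and C = C and A = "(\<lambda>s. - \<gamma> s) ` A"])
    have "X \<subseteq> \<phi> ` U" unfolding X_def using balls rV by blast
    then show "compact (\<psi> ` X)"
      by (intro compact_continuous_image continuous_on_subset[OF c\<psi>]) (simp_all add: X_def)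
    show "open (\<psi> ` ball e \<sigma>)" using o\<psi> \<sigma> r2 by auto
    show "0 \<in> \<psi> ` ball e \<sigma>" using \<psi>e \<sigma>(1) by (intro image_eqI[of _ _ e]) auto
    show "\<psi> ` ball e \<sigma> \<subseteq> \<psi> ` X" unfolding X_def by (intro image_mono ball_subset_cball)
    show "|(\<lambda>s. - \<gamma> s) ` A| \<le>o cof_null" by (rule image_le_cof_null[OF CA(4)])
    show "\<psi> ` X \<subseteq> (\<Union>a\<in>(\<lambda>s. - \<gamma> s) ` A. (+) a ` C)"
    proof
      fix x assume "x \<in> \<psi> ` X"
      then obtain q where q: "q \<in> X" "x = \<psi> q" by blast
      obtain s where s: "s \<in> A" "g s q \<in> C1" using CA(5) q(1) by blast
      have s\<sigma>: "s \<in> {0..\<sigma>}" using s(1) CA(3) by blast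
      let ?y = "M (e + s *\<^sub>R b, q)"
      have "\<psi> ?y = \<gamma> s + x"
        using XS(1)[OF s\<sigma> q(1)] by (simp add: S M \<gamma>_def q(2) \<psi>\<phi>)
      moreover have "?y \<in> cball e r2 \<inter> (\<lambda>y. y \<bullet> b) -` C1"
        using XS(2)[OF s\<sigma> q(1)] s(2) by (simp add: g_def)
      ultimately have "\<gamma> s + x \<in> C" unfolding C_def by (metis imageI)
      then have "x \<in> (+) (- \<gamma> s) ` C" by (simp add: mem_translate_iff)
      then show "x \<in> (\<Union>a\<in>(\<lambda>s. - \<gamma> s) ` A. (+) a ` C)" using s(1) by blast
    qed
  qed (rule cC hn idx)+
qed

theorem theorem3p3:
  fixes \<A> :: "('a::{topological_group_add,t2_space}, 'e::euclidean_space) chart set"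
  assumes "lie_group \<A>"
    and "\<not> discrete (UNIV :: 'a set)"
    and "|left_cosets (identity_component :: 'a set)| \<le>o cof_null"
  shows "nice_group TYPE('a)"
proof -
  have atlas: "smooth_atlas \<A>" using assms(1) unfolding lie_group_def by (rule conjunct1)
  then have "\<Union> (fst ` \<A>) = UNIV" unfolding smooth_atlas_def by blast
  then obtain c where "c \<in> \<A>" "0 \<in> fst c" by blast
  then obtain U \<phi> where U: "(U, \<phi>) \<in> \<A>" "0 \<in> U" by (cases c) auto
  show ?thesis
  proof (rule nice_group_if_C1_chart[OF _ U(2) _ assms(3)])
    show "is_chart (U, \<phi>)" using atlas U(1) unfolding smooth_atlas_def by blast
    have "\<forall>(U, \<phi>)\<in>\<A>. \<forall>(V, \<psi>)\<in>\<A>. \<forall>(W, \<theta>)\<in>\<A>.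
        smooth_on (\<lambda>(p, q). \<theta> (inv_into U \<phi> p + inv_into V \<psi> q))
          {(p, q). p \<in> \<phi> ` U \<and> q \<in> \<psi> ` V \<and> inv_into U \<phi> p + inv_into V \<psi> q \<in> W}"
      using assms(1) unfolding lie_group_def by (elim conjE)
    from bspec[OF this U(1), simplified, THEN bspec, OF U(1), simplified, THEN bspec, OF U(1), simplified]
    have "smooth_on (\<lambda>(p, q). \<phi> (inv_into U \<phi> p + inv_into U \<phi> q))
        {(p, q). p \<in> \<phi> ` U \<and> q \<in> \<phi> ` U \<and> inv_into U \<phi> p + inv_into U \<phi> q \<in> U}"
      by simp
    then show "Ck_on 1 (\<lambda>(p, q). \<phi> (inv_into U \<phi> p + inv_into U \<phi> q))
        {(p, q). p \<in> \<phi> ` U \<and> q \<in> \<phi> ` U \<and> inv_into U \<phi> p + inv_into U \<phi> q \<in> U}"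
      unfolding smooth_on_def by blast
  qed
qed

end
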